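(* Let $n\ge 1$ and let $K\subset\mathbb{R}^n$ be a convex body with $0\in\mathrm{int}\,K$. Then $$\mathcal{M}(K)\;\ge\;\left(\frac{\pi}{4}\right)^n .$$
   Context: A convex body in $\mathbb{R}^n$ is a compact convex set with non-empty interior. $|\cdot|$ denotes Lebesgue measure. For a convex body $K$ with $0\in\mathrm{int}\,K$, its polar is $K^\circ=\{y\in\mathbb{R}^n:\langle x,y\rangle\le 1\text{ for all }x\in K\}$, and its Mahler volume is $\mathcal{M}(K)=n!\,|K|\,|K^\circ|$ (note the factor $n!$). *)

theory Defs
  imports "HOL-Analysis.Analysis"
begin

definition convex_body :: "'a::euclidean_space set \<Rightarrow> bool" where
  "convex_body K \<longleftrightarrow> compact K \<and> convex K \<and> interior K \<noteq> {}"

definition polar :: "'a::euclidean_space set \<Rightarrow> 'a set" where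
  "polar K = {y. \<forall>x\<in>K. x \<bullet> y \<le> 1}"

(* This normalisation of the Mahler volume includes the factor n!.
   Both measures are finite when K is a convex body with 0 in its interior,
   so the real-valued measure is the actual volume. *)
definition mahler_volume :: "'a::euclidean_space set \<Rightarrow> real" where
  "mahler_volume K = fact DIM('a) * measure lebesgue K * measure lebesgue (polar K)"

end

theory Submission
  imports Defs "HOL-Complex_Analysis.Complex_Analysis" "HOL-Probability.Distributions"
begin

text \<open>
The proof first replaces \<open>K\<close> by a centrally symmetric body and then bounds the Mahler volume of
symmetric bodies below by \<open>\<pi>\<^sup>n\<close>, a constant found by Kuperberg. The argument for symmetric bodies is
the complex-analytic one in the spirit of Berndtsson.

Reduction. Let \<open>A = K - K\<close>. A Fubini argument gives \<open>|A| \<le> 4\<^sup>n |K|\<close>, and \<open>2 A\<^sup>o\<close> is contained in the union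
of \<open>K\<^sup>o\<close> and \<open>- K\<^sup>o\<close>, so that \<open>2\<^sup>n |A\<^sup>o| \<le> 2 |K\<^sup>o|\<close>. Hence \<open>\<pi>\<^sup>n \<le> M(A) \<le> 2 \<cdot> 2\<^sup>n M(K) \<le> 4\<^sup>n M(K)\<close>.

Symmetric bodies. Let \<open>P = K\<^sup>o\<close> and let \<open>T\<close> be the gradient of a smooth uniformly convex function \<open>\<phi>\<close>
close to the support function of \<open>P\<close>. Two facts about pairs \<open>(u, v)\<close> are combined.

  \<^item> By convexity and symmetry, \<open>exp (- (u \<bullet> T u + v \<bullet> T v) / 2)\<close> is at most \<open>\<Psi> (u + v, T u - T v)\<close>, where
    \<open>\<Psi> (a, b)\<close> is a product of a function of \<open>a\<close> and a function of \<open>b\<close>, and the integral of \<open>\<Psi>\<close> tends to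
    \<open>n! |2 K| |2 P| = 4\<^sup>n M(K)\<close> as \<open>\<phi>\<close> approaches the support function (\<open>symmetric_body_integral_bound\<close>,
    \<open>tendsto_integral_truncation\<close>).
  \<^item> If \<open>\<Psi> (u + v, T u - T v)\<close> dominates \<open>exp (- (u \<bullet> T u + v \<bullet> T v) / 2)\<close> then the integral of \<open>\<Psi>\<close> is at
    least \<open>(4 \<pi>)\<^sup>n\<close> (\<open>monotone_graph_volume_bound\<close>).

For the second fact put \<open>a = u + s v\<close> and \<open>b = T u - s T v\<close>. For real \<open>s > 0\<close> the map \<open>(u, v) \<mapsto> (a, b)\<close> is a
bijection, because \<open>T\<close> is strongly monotone, and its Jacobian is \<open>J (u, v)\<close> times a factor that depends
only on \<open>s\<close>, where \<open>J\<close> is the Jacobian for \<open>s = 1\<close>. So for every function \<open>F\<close> the integral of \<open>F (a, b) J\<close>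
does not depend on \<open>T\<close>; it has the same value for the identity in place of \<open>T\<close>. For a Gaussian \<open>F\<close> both
integrals extend holomorphically in \<open>s\<close> (\<open>a\<close> and \<open>b\<close> become complex vectors, \<open>J\<close> stays as it is), so they
still agree at \<open>s = \<i>\<close>. There one can take \<open>F = exp (- a \<bullet> b / 2)\<close> with the bilinear product, and
\<open>Re (a \<bullet> b) = u \<bullet> T u + v \<bullet> T v\<close>. Hence the integral of \<open>exp (- (u \<bullet> T u + v \<bullet> T v) / 2) J\<close> is at least its
value for the identity, which is the Gaussian integral \<open>(4 \<pi>)\<^sup>n\<close>. The point that needs care is convergence
along a path from \<open>s = 1\<close> to \<open>s = \<i>\<close>: this is \<open>coercive_arc\<close>.
\<close>

section \<open>Change of variables in Euclidean spaces\<close>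

text \<open>
Sending the standard basis of \<open>\<real>\<^sup>m\<close> to an orthonormal basis maps boxes to boxes of the same volume. This
carries statements about determinants from \<open>\<real>\<^sup>m\<close> to any Euclidean space, in particular to
\<open>\<real>\<^sup>n \<times> \<real>\<^sup>n\<close>.
\<close>

lemma coordinates_preserving_lebesgue:
  assumes "CARD('m::finite) = DIM('b::euclidean_space)"
  obtains J :: "real^'m::finite \<Rightarrow> 'b::euclidean_space" and J' where
    "linear J" "linear J'" "\<And>x. J (J' x) = x" "\<And>x. J' (J x) = x"
    "distr lborel borel J = lborel" "distr lborel borel J' = lborel"
proof -
  obtain e :: "'b \<Rightarrow> 'm" where e: "bij_betw e Basis UNIV"
    using assms finite_same_card_bij[OF finite_Basis[where 'a='b] finite_class.finite_UNIV[where 'a='m]]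
    by auto
  define J :: "real^'m \<Rightarrow> 'b" where "J = (\<lambda>x. \<Sum>b\<in>Basis. (x $ e b) *\<^sub>R b)"
  define J' :: "'b \<Rightarrow> real^'m" where "J' = (\<lambda>y. \<chi> i. y \<bullet> (inv_into Basis e i))"
  have inv1: "inv_into Basis e (e b) = b" if "b \<in> Basis" for b
    using e that by (simp add: bij_betw_def)
  have inv2: "e (inv_into Basis e i) = i" "inv_into Basis e i \<in> Basis" for i
    using e by (auto simp: bij_betw_def f_inv_into_f inv_into_into)
  have inner_J: "J x \<bullet> b = x $ e b" if "b \<in> Basis" for x b
    unfolding J_def using that by (simp add: inner_sum_left inner_Basis if_distrib sum.delta cong: if_cong)
  have lin: "linear J" "linear J'"
    unfolding J_def J'_def
    by (auto intro!: linearI simp: vec_eq_iff inner_add_left scaleR_add_left sum.distrib scaleR_sum_right)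
  have JJ': "J (J' x) = x" for x
    by (rule euclidean_eqI) (simp add: inner_J J'_def inv1)
  have J'J: "J' (J x) = x" for x
    by (simp add: vec_eq_iff J'_def inner_J inv2)
  have meas: "J \<in> borel_measurable borel" "J' \<in> borel_measurable borel"
    using lin by (auto intro!: borel_measurable_continuous_onI linear_continuous_on simp: linear_conv_bounded_linear)
  have prodJ: "(\<Prod>b\<in>Basis. (w::real^'m) \<bullet> b) = (\<Prod>b\<in>(Basis::'b set). w $ e b)" for w
  proof -
    have "(\<Prod>b\<in>Basis. w \<bullet> b) = (\<Prod>i\<in>UNIV. w $ i)"
      by (simp add: Basis_vec_def prod.reindex inj_on_def axis_eq_axis UNION_singleton_eq_range cart_eq_inner_axis)
    also have "\<dots> = (\<Prod>b\<in>Basis. w $ e b)"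
      using prod.reindex_bij_betw[OF e, of "\<lambda>i. w $ i"] by simp
    finally show ?thesis .
  qed
  have distrJ: "distr lborel borel J = lborel"
  proof (rule lborel_eqI[symmetric])
    fix l u :: 'b assume le: "\<And>b. b \<in> Basis \<Longrightarrow> l \<bullet> b \<le> u \<bullet> b"
    have "J -` box l u = box (J' l) (J' u)"
    proof -
      have "J x \<in> box l u \<longleftrightarrow> x \<in> box (J' l) (J' u)" for x
      proof -
        have "J x \<in> box l u \<longleftrightarrow> (\<forall>b\<in>Basis. l \<bullet> b < x $ e b \<and> x $ e b < u \<bullet> b)"
          by (simp add: mem_box inner_J)
        also have "\<dots> \<longleftrightarrow> (\<forall>i. J' l $ i < x $ i \<and> x $ i < J' u $ i)"
          by (simp add: J'_def) (metis inv1 inv2)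
        finally show ?thesis by (simp add: mem_box_cart)
      qed
      then show ?thesis by auto
    qed
    then show "emeasure (distr lborel borel J) (box l u) = (\<Prod>b\<in>Basis. (u - l) \<bullet> b)"
      using le meas
      apply (simp add: emeasure_distr)
      apply (subst emeasure_lborel_box)
       apply (auto simp: Basis_vec_def inner_axis J'_def inv2)[1]
      apply (subst prodJ)
      apply (simp add: J'_def inv1 inner_diff_left cong: prod.cong)
      done
  qed simp
  have "distr lborel borel J' = distr (distr lborel borel J) borel J'"
    by (simp add: distrJ)
  also have "\<dots> = distr lborel borel (J' \<circ> J)"
    using meas by (intro distr_distr) auto
  also have "\<dots> = lborel"
  proof -
    have "J' \<circ> J = id" using J'J by auto
    then show ?thesis
      by (simp add: id_def) (metis distr_id2 sets_lborel)
  qed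
  finally have "distr lborel borel J' = lborel" .
  with that lin JJ' J'J distrJ show ?thesis by blast
qed

text \<open>
Change of variables for a bijection, stated for measures, so that one equation serves
nonnegative and complex integrands alike. It is enough to check it on boxes, whose preimages are open sets with
a known volume integral.
\<close>

lemma lborel_change_of_variables_cart:
  fixes g :: "real^'m::{finite,wellorder} \<Rightarrow> real^'m::_"
  assumes der: "\<And>x. (g has_derivative g' x) (at x)"
    and cont: "\<And>h. continuous_on UNIV (\<lambda>x. g' x h)"
    and bij: "bij g"
  shows "(\<lambda>x. \<bar>det (matrix (g' x))\<bar>) \<in> borel_measurable borel"
    and "distr (density lborel (\<lambda>x. ennreal \<bar>det (matrix (g' x))\<bar>)) borel g = lborel"
proof -
  have "continuous_on UNIV (\<lambda>x. \<bar>det (matrix (g' x))\<bar>)"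
    unfolding det_def matrix_def
    by (simp, intro continuous_intros continuous_on_component cont)
  then show meas [measurable]: "(\<lambda>x. \<bar>det (matrix (g' x))\<bar>) \<in> borel_measurable borel"
    by (rule borel_measurable_continuous_onI)
  have contg: "continuous_on UNIV g"
    using der by (meson continuous_at_imp_continuous_on has_derivative_continuous)
  then have [measurable]: "g \<in> borel_measurable borel"
    by (rule borel_measurable_continuous_onI)
  show "distr (density lborel (\<lambda>x. ennreal \<bar>det (matrix (g' x))\<bar>)) borel g = lborel"
  proof (rule lborel_eqI[symmetric])
    fix l u :: "real^'m::_" assume le: "\<And>b. b \<in> Basis \<Longrightarrow> l \<bullet> b \<le> u \<bullet> b"
    define S where "S = g -` box l u"
    have S: "open S" unfolding S_def using contg by (intro open_vimage) auto
    have img: "g ` S = box l u"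
      unfolding S_def using bij by (simp add: bij_def surj_image_vimage_eq)
    have "((\<lambda>x. \<bar>det (matrix (g' x))\<bar>) has_integral measure lebesgue (box l u)) S"
      using has_measure_differentiable_image[of S g g' "measure lebesgue (box l u)"] S bij
        has_derivative_at_withinI[OF der]
      by (auto simp: img bij_def inj_on_subset)
    then have "(\<integral>\<^sup>+x. ennreal \<bar>det (matrix (g' x))\<bar> * indicator S x \<partial>lborel) = measure lebesgue (box l u)"
      by (intro nn_integral_has_integral_lebesgue') auto
    also have "\<dots> = (\<Prod>b\<in>Basis. (u - l) \<bullet> b)"
      using le by (simp add: measure_def)
    finally show "emeasure (distr (density lborel (\<lambda>x. ennreal \<bar>det (matrix (g' x))\<bar>)) borel g) (box l u)
        = (\<Prod>b\<in>Basis. (u - l) \<bullet> b)"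
      using S by (simp add: emeasure_distr emeasure_density S_def)
  qed simp
qed

text \<open>
The functional \<open>jac\<close> stands for \<open>L \<mapsto> |det L|\<close> on a Euclidean space such as \<open>\<real>\<^sup>n \<times> \<real>\<^sup>n\<close>. Its values are
never computed: multiplicativity, positivity and the change of variables formula suffice.
\<close>

locale abs_det =
  fixes jac :: "('b::euclidean_space \<Rightarrow> 'b) \<Rightarrow> real"
  assumes jac_nonneg: "0 \<le> jac L"
    and jac_compose: "linear L \<Longrightarrow> linear M \<Longrightarrow> jac (L \<circ> M) = jac L * jac M"
    and jac_pos: "linear L \<Longrightarrow> bij L \<Longrightarrow> 0 < jac L"
    and jac_change: "(\<And>x. (F has_derivative F' x) (at x)) \<Longrightarrow> (\<And>h. continuous_on UNIV (\<lambda>x. F' x h)) \<Longrightarrow> bij F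
      \<Longrightarrow> (\<lambda>x. jac (F' x)) \<in> borel_measurable borel \<and>
          distr (density lborel (\<lambda>x. ennreal (jac (F' x)))) borel F = lborel"

lemma jacobian_functional:
  assumes card: "CARD('m::{finite,wellorder}) = DIM('b::euclidean_space)"
  obtains jac :: "('b::euclidean_space \<Rightarrow> 'b) \<Rightarrow> real" where "abs_det jac"
proof -
  obtain J :: "real^'m::{finite,wellorder} \<Rightarrow> 'b" and J' where J: "linear J" "linear J'"
    and inv: "\<And>x. J (J' x) = x" "\<And>x. J' (J x) = x"
    and distr: "distr lborel borel J = lborel" "distr lborel borel J' = lborel"
    using coordinates_preserving_lebesgue[OF card] by metis
  define jac where "jac L = \<bar>det (matrix (J' \<circ> L \<circ> J))\<bar>" for L :: "'b \<Rightarrow> 'b"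
  have blin: "bounded_linear J" "bounded_linear J'"
    using J by (auto simp: linear_conv_bounded_linear)
  have contJ: "continuous_on A J" "continuous_on B J'" for A B
    using blin by (auto intro: linear_continuous_on)
  have [measurable]: "J \<in> borel_measurable borel" "J' \<in> borel_measurable borel"
    using contJ by (auto intro: borel_measurable_continuous_onI)
  have lin: "linear (J' \<circ> L \<circ> J)" if "linear L" for L
    using J that by (intro linear_compose)
  have mult: "jac (L \<circ> M) = jac L * jac M" if "linear L" "linear M" for L M
  proof -
    have "J' \<circ> (L \<circ> M) \<circ> J = (J' \<circ> L \<circ> J) \<circ> (J' \<circ> M \<circ> J)"
      by (auto simp: inv)
    then show ?thesis
      unfolding jac_def using matrix_compose[OF lin[OF that(2)] lin[OF that(1)]]
      by (simp add: det_mul abs_mult)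
  qed
  have jac_id: "jac (\<lambda>x. x) = 1"
  proof -
    have "J' \<circ> (\<lambda>x. x) \<circ> J = (\<lambda>x. x)" by (auto simp: inv)
    then show ?thesis unfolding jac_def by (simp add: matrix_id_mat_1[unfolded id_def] id_def)
  qed
  have pos: "0 < jac L" if L: "linear L" "bij L" for L
  proof -
    obtain M where M: "linear M" "L \<circ> M = id"
      using L linear_surjective_right_inverse[of L] by (auto simp: bij_def)
    then have "jac L * jac M = 1"
      using mult[OF L(1) M(1)] jac_id by (simp add: id_def)
    then show ?thesis
      by (metis jac_def abs_ge_zero mult_zero_left less_le zero_neq_one)
  qed
  have change: "(\<lambda>x. jac (G' x)) \<in> borel_measurable borel \<and>
          distr (density lborel (\<lambda>x. ennreal (jac (G' x)))) borel G = lborel"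
    if der: "\<And>x. (G has_derivative G' x) (at x)" and cont: "\<And>h. continuous_on UNIV (\<lambda>x. G' x h)"
      and bij: "bij G" for G G'
  proof -
    define g where "g = J' \<circ> G \<circ> J"
    define g' where "g' x = J' \<circ> G' (J x) \<circ> J" for x
    have derg: "(g has_derivative g' x) (at x)" for x
      unfolding g_def g'_def
      by (intro diff_chain_at bounded_linear_imp_has_derivative blin) (simp add: der)
    have contg: "continuous_on UNIV (\<lambda>x. g' x h)" for h
      unfolding g'_def comp_def
      by (intro continuous_on_compose2[OF contJ(2)] continuous_on_compose2[OF cont] contJ) auto
    have "bij J" "bij J'"
      using inv by (metis bijI')+
    then have bijg: "bij g"
      unfolding g_def using bij by (intro bij_comp)
    have jac_g: "jac (G' (J x)) = \<bar>det (matrix (g' x))\<bar>" for x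
      unfolding jac_def g'_def by simp
    note cv = lborel_change_of_variables_cart[OF derg contg bijg]
    have "(\<lambda>x. jac (G' (J (J' x)))) \<in> borel_measurable borel"
      using measurable_compose[OF _ cv(1), of J' borel] by (simp add: jac_g)
    then have meas [measurable]: "(\<lambda>x. jac (G' x)) \<in> borel_measurable borel"
      by (simp add: inv)
    have "continuous_on UNIV G"
      using der by (meson continuous_at_imp_continuous_on has_derivative_continuous)
    then have [measurable]: "G \<in> borel_measurable borel"
      by (rule borel_measurable_continuous_onI)
    have [measurable]: "g \<in> borel_measurable borel"
      unfolding g_def by measurable
    have "distr (density lborel (\<lambda>x. ennreal (jac (G' x)))) borel G
        = distr (density (distr lborel borel J) (\<lambda>x. ennreal (jac (G' x)))) borel G"
      by (simp add: distr)
    also have "\<dots> = distr (distr (density lborel (\<lambda>x. ennreal (jac (G' (J x))))) borel J) borel G"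
      by (subst density_distr) auto
    also have "\<dots> = distr (density lborel (\<lambda>x. ennreal (jac (G' (J x))))) borel (G \<circ> J)"
      by (subst distr_distr) auto
    also have "G \<circ> J = J \<circ> g"
      by (auto simp: g_def inv)
    also have "distr (density lborel (\<lambda>x. ennreal (jac (G' (J x))))) borel (J \<circ> g)
        = distr (distr (density lborel (\<lambda>x. ennreal (jac (G' (J x))))) borel g) borel J"
      by (subst distr_distr) auto
    also have "\<dots> = lborel"
      unfolding jac_g cv(2) distr ..
    finally show ?thesis using meas by simp
  qed
  have "abs_det jac"
  proof
    show "0 \<le> jac L" for L by (simp add: jac_def)
  qed (use mult pos change in blast)+
  then show ?thesis by (rule that)
qed

section \<open>Strongly monotone maps, Gaussian integrals and integrals depending on a parameter\<close>

text \<open>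
Zarantonello's argument: \<open>M x = b\<close> is a fixed point equation for \<open>x \<mapsto> x - t (M x - b)\<close>, and strong
monotonicity makes this map a contraction for small \<open>t\<close>.
\<close>

lemma strongly_monotone_lipschitz_bij:
  fixes M :: "'a::euclidean_space \<Rightarrow> 'a"
  assumes \<epsilon>: "0 < \<epsilon>" and mono: "\<And>x y. \<epsilon> * (norm (x - y))\<^sup>2 \<le> (M x - M y) \<bullet> (x - y)"
    and lip: "\<And>x y. norm (M x - M y) \<le> C * norm (x - y)"
  shows "bij M"
proof -
  have "inj M"
  proof (rule injI)
    fix x y assume "M x = M y"
    then have "\<epsilon> * (norm (x - y))\<^sup>2 \<le> 0" using mono[of x y] by simp
    then show "x = y" using \<epsilon> by (simp add: mult_le_0_iff)
  qed
  moreover have "surj M"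
  proof -
    define B where "B = max C \<epsilon>"
    have B: "0 < B" "\<epsilon> \<le> B" "norm (M x - M y) \<le> B * norm (x - y)" for x y
      using \<epsilon> lip[of x y] mult_right_mono[of C B "norm (x - y)"] by (auto simp: B_def)
    \<comment> \<open>The value of \<open>t\<close> that minimises the bound \<open>1 - 2 t \<epsilon> + t\<^sup>2 B\<^sup>2\<close> on the squared contraction factor.\<close>
    define t where "t = \<epsilon> / B\<^sup>2"
    define q where "q = sqrt (1 - \<epsilon>\<^sup>2 / B\<^sup>2)"
    have le1: "\<epsilon>\<^sup>2 / B\<^sup>2 \<le> 1" using B \<epsilon> by (simp add: power_mono)
    have q: "0 \<le> q" "q < 1" "q\<^sup>2 = 1 - \<epsilon>\<^sup>2 / B\<^sup>2"
      using le1 B \<epsilon> by (auto simp: q_def)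
    have "\<exists>x. M x = b" for b
    proof -
      define F where "F x = x - t *\<^sub>R (M x - b)" for x
      have "dist (F x) (F y) \<le> q * dist x y" for x y
      proof -
        have "(norm (F x - F y))\<^sup>2 = (norm ((x - y) - t *\<^sub>R (M x - M y)))\<^sup>2"
          by (simp add: F_def algebra_simps)
        also have "\<dots> = (norm (x - y))\<^sup>2 - 2 * t * ((M x - M y) \<bullet> (x - y)) + t\<^sup>2 * (norm (M x - M y))\<^sup>2"
          by (simp only: power2_norm_eq_inner) (simp add: inner_diff inner_commute algebra_simps power2_eq_square)
        also have "\<dots> \<le> (norm (x - y))\<^sup>2 - 2 * t * (\<epsilon> * (norm (x - y))\<^sup>2) + t\<^sup>2 * (B * norm (x - y))\<^sup>2"
          using mono[of x y] B \<epsilon> by (intro add_mono diff_mono mult_left_mono power_mono) (auto simp: t_def)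
        also have "\<dots> = (1 - \<epsilon>\<^sup>2 / B\<^sup>2) * (norm (x - y))\<^sup>2"
          using B by (simp add: t_def field_simps power2_eq_square)
        also have "\<dots> = (q * norm (x - y))\<^sup>2"
          using q(3) by (simp add: power_mult_distrib)
        finally show ?thesis
          using q(1) by (simp add: dist_norm abs_le_square_iff[symmetric] power2_le_iff_abs_le)
      qed
      then obtain x where "F x = x"
        using banach_fix_type[OF q(1,2), of F] by blast
      then show ?thesis
        using B \<epsilon> by (intro exI[of _ x]) (auto simp: F_def t_def)
    qed
    then show ?thesis by (metis surjI)
  qed
  ultimately show ?thesis by (simp add: bij_def)
qed

lemma nn_integral_gaussian:
  assumes k: "0 < (k::real)"
  shows "(\<integral>\<^sup>+x. ennreal (exp (- (k * (norm x)\<^sup>2))) \<partial>(lborel :: 'b::euclidean_space measure))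
      = ennreal (sqrt (pi / k) ^ DIM('b))"
proof -
  have one: "(\<integral>\<^sup>+t. ennreal (exp (- (k * t\<^sup>2))) \<partial>lborel) = ennreal (sqrt (pi / k))"
  proof -
    define \<sigma> where "\<sigma> = sqrt (1 / (2 * k))"
    have \<sigma>: "\<sigma>\<^sup>2 = 1 / (2 * k)" "0 < \<sigma>" using k by (auto simp: \<sigma>_def)
    have eq: "exp (- (k * t\<^sup>2)) = sqrt (pi / k) * normal_density 0 \<sigma> t" for t
      using k by (simp add: normal_density_def \<sigma> field_simps)
    have "(\<integral>\<^sup>+t. ennreal (exp (- (k * t\<^sup>2))) \<partial>lborel)
        = ennreal (\<integral>t. sqrt (pi / k) * normal_density 0 \<sigma> t \<partial>lborel)"
      unfolding eq using k \<sigma> by (intro nn_integral_eq_integral) (auto intro!: AE_I2)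
    then show ?thesis using \<sigma> by simp
  qed
  have "(\<integral>\<^sup>+x. ennreal (exp (- (k * (norm x)\<^sup>2))) \<partial>(lborel :: 'b measure))
      = (\<integral>\<^sup>+x. (\<Prod>b\<in>Basis. ennreal (exp (- (k * (x \<bullet> b)\<^sup>2)))) \<partial>(lborel :: 'b measure))"
  proof (rule nn_integral_cong)
    fix x :: 'b
    have "(norm x)\<^sup>2 = (\<Sum>b\<in>Basis. (x \<bullet> b)\<^sup>2)"
      unfolding power2_norm_eq_inner by (subst euclidean_inner) (simp add: power2_eq_square)
    then show "ennreal (exp (- (k * (norm x)\<^sup>2))) = (\<Prod>b\<in>Basis. ennreal (exp (- (k * (x \<bullet> b)\<^sup>2))))"
      by (simp add: prod_ennreal sum_distrib_left sum_negf[symmetric] exp_sum del: sum_negf)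
  qed
  also have "\<dots> = (\<Prod>b\<in>(Basis::'b set). \<integral>\<^sup>+t. ennreal (exp (- (k * t\<^sup>2))) \<partial>lborel)"
    by (rule nn_integral_lborel_prod) auto
  also have "\<dots> = ennreal (sqrt (pi / k) ^ DIM('b))"
    using k by (simp add: one ennreal_power)
  finally show ?thesis .
qed

text \<open>
Differentiation under the integral sign. Local domination of the integrand is enough, because
Cauchy's estimate turns it into a domination of the difference quotients.
\<close>

lemma holomorphic_on_integral:
  fixes h :: "complex \<Rightarrow> 'w \<Rightarrow> complex"
  assumes hol: "\<And>w. (\<lambda>s. h s w) holomorphic_on U"
    and meas [measurable]: "\<And>s. s \<in> U \<Longrightarrow> h s \<in> borel_measurable M"
    and dom: "\<And>s. s \<in> U \<Longrightarrow> \<exists>r>0. \<exists>g. integrable M g \<and> ball s r \<subseteq> U \<and> (\<forall>t\<in>ball s r. \<forall>w. norm (h t w) \<le> g w)"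
  shows "(\<lambda>s. \<integral>w. h s w \<partial>M) holomorphic_on U"
proof -
  have "\<exists>d. ((\<lambda>s. \<integral>w. h s w \<partial>M) has_field_derivative d) (at s)" if s: "s \<in> U" for s
  proof -
    obtain r g where r: "0 < r" "ball s r \<subseteq> U" and g: "integrable M g"
      and le: "\<And>t w. t \<in> ball s r \<Longrightarrow> norm (h t w) \<le> g w"
      using dom[OF s] by blast
    define h' where "h' w = deriv (\<lambda>s. h s w) s" for w
    have holb: "(\<lambda>s. h s w) holomorphic_on ball s r" for w
      using hol r(2) holomorphic_on_subset by blast
    have der: "((\<lambda>s. h s w) has_field_derivative deriv (\<lambda>s. h s w) t) (at t)" if "t \<in> ball s r" for t w
      using holb that holomorphic_derivI open_ball by blast
    have derle: "norm (deriv (\<lambda>s. h s w) t) \<le> 4 / r * g w" if t: "t \<in> ball s (r/2)" for t w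
    proof -
      have sub: "cball t (r/4) \<subseteq> ball s r"
      proof
        fix z assume "z \<in> cball t (r/4)"
        then show "z \<in> ball s r"
          using t r(1) dist_triangle[of s z t] by (simp add: dist_commute)
      qed
      have "norm ((deriv ^^ 1) (\<lambda>s. h s w) t) \<le> fact 1 * g w / (r/4)^1"
      proof (rule Cauchy_inequality)
        show "(\<lambda>s. h s w) holomorphic_on ball t (r/4)"
          using holb sub ball_subset_cball holomorphic_on_subset by blast
        show "continuous_on (cball t (r/4)) (\<lambda>s. h s w)"
          using holb sub holomorphic_on_imp_continuous_on holomorphic_on_subset by blast
        show "norm (h z w) \<le> g w" if "norm (t - z) = r/4" for z
          using that sub by (intro le) (auto simp: dist_norm)
      qed (use r in auto)
      then show ?thesis by (simp add: mult.commute)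
    qed
    have int: "integrable M (h t)" if "t \<in> ball s r" for t
      using that r le meas by (intro Bochner_Integration.integrable_bound[OF g])
        (auto intro!: AE_I2 order_trans[OF le])
    have meas': "h' \<in> borel_measurable M"
    proof (rule borel_measurable_LIMSEQ_metric)
      define \<rho> where "\<rho> n = r / (2 * (real n + 1))" for n
      define X where "X n = s + of_real (\<rho> n)" for n
      have "0 < \<rho> n" "\<rho> n < r" for n
        using r(1) by (auto simp: \<rho>_def field_simps add_pos_nonneg)
      then have X: "X n \<in> ball s r" "X n \<noteq> s" for n
        by (auto simp: X_def dist_norm less_imp_le less_imp_neq[symmetric])
      have "\<rho> \<longlonglongrightarrow> 0" unfolding \<rho>_def by real_asymp
      then have "X \<longlonglongrightarrow> s + of_real 0"
        unfolding X_def by (intro tendsto_intros)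
      then have "filterlim X (at s) sequentially"
        using X by (auto simp: filterlim_at)
      then show "(\<lambda>n. (h (X n) w - h s w) / (X n - s)) \<longlonglongrightarrow> h' w" for w
        using der[of s w] r(1) unfolding has_field_derivative_iff h'_def
        by (auto intro: filterlim_compose)
      show "(\<lambda>w. (h (X n) w - h s w) / (X n - s)) \<in> borel_measurable M" for n
        using X r s by (intro borel_measurable_divide borel_measurable_diff meas) auto
    qed
    have "((\<lambda>t. \<integral>w. h t w \<partial>M) has_field_derivative (\<integral>w. h' w \<partial>M)) (at s)"
      unfolding has_field_derivative_iff tendsto_at_iff_sequentially comp_def
    proof (intro allI impI)
      fix X :: "nat \<Rightarrow> complex" assume "\<forall>i. X i \<in> UNIV - {s}" and X: "X \<longlonglongrightarrow> s"
      then have ne: "X i \<noteq> s" for i by auto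
      have filt: "filterlim X (at s) sequentially"
        using X ne by (simp add: filterlim_at)
      obtain N where N: "\<And>n. X (n + N) \<in> ball s (r/2)"
        using X r(1) unfolding lim_sequentially
        by (metis dist_commute half_gt_zero le_add2 mem_ball)
      have quot: "norm ((h t w - h s w) / (t - s)) \<le> 4 / r * g w" if "t \<in> ball s (r/2)" "t \<noteq> s" for t w
      proof -
        have "norm (h t w - h s w) \<le> (4 / r * g w) * norm (t - s)"
        proof (rule field_differentiable_bound[of "ball s (r/2)"])
          show "((\<lambda>s. h s w) has_field_derivative deriv (\<lambda>s. h s w) z) (at z within ball s (r/2))"
            if "z \<in> ball s (r/2)" for z
            using that der[of z w] r(1) by (auto intro: has_field_derivative_at_within)
        qed (use that r derle in auto)
        then show ?thesis using that by (simp add: norm_divide field_simps)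
      qed
      have "(\<lambda>n. \<integral>w. (h (X (n + N)) w - h s w) / (X (n + N) - s) \<partial>M) \<longlonglongrightarrow> (\<integral>w. h' w \<partial>M)"
      proof (rule integral_dominated_convergence[where w = "\<lambda>w. 4 / r * g w"])
        show "(\<lambda>w. (h (X (n + N)) w - h s w) / (X (n + N) - s)) \<in> borel_measurable M" for n
          using N[of n] r s by (intro borel_measurable_divide borel_measurable_diff meas) (auto simp: subset_iff)
        show "AE w in M. (\<lambda>n. (h (X (n + N)) w - h s w) / (X (n + N) - s)) \<longlonglongrightarrow> h' w"
        proof (rule AE_I2)
          fix w
          have "(\<lambda>n. (h (X n) w - h s w) / (X n - s)) \<longlonglongrightarrow> h' w"
            using der[of s w] r(1) filt unfolding has_field_derivative_iff h'_def
            by (auto intro: filterlim_compose)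
          then show "(\<lambda>n. (h (X (n + N)) w - h s w) / (X (n + N) - s)) \<longlonglongrightarrow> h' w"
            by (rule LIMSEQ_ignore_initial_segment)
        qed
        show "AE w in M. norm ((h (X (n + N)) w - h s w) / (X (n + N) - s)) \<le> 4 / r * g w" for n
          using quot[OF N ne] by simp
      qed (use g meas' in auto)
      moreover have "(\<integral>w. (h (X (n + N)) w - h s w) / (X (n + N) - s) \<partial>M)
          = ((\<integral>w. h (X (n + N)) w \<partial>M) - (\<integral>w. h s w \<partial>M)) / (X (n + N) - s)" for n
        using int[of "X (n + N)"] int[of s] N[of n] r(1) by simp
      ultimately show "(\<lambda>n. ((\<integral>w. h (X n) w \<partial>M) - (\<integral>w. h s w \<partial>M)) / (X n - s)) \<longlonglongrightarrow> (\<integral>w. h' w \<partial>M)"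
        by - (rule LIMSEQ_offset[where k=N], simp only:)
    qed
    then show ?thesis by blast
  qed
  then show ?thesis
    unfolding holomorphic_on_def field_differentiable_def
    by (meson has_field_derivative_at_within)
qed

section \<open>The twisted integral of a monotone map\<close>

text \<open>
For real \<open>s > 0\<close> put \<open>a = u + s v\<close> and \<open>b = T u - s T v\<close>. Then the phase is
\<open>(l (s + 1/s) / 2 \<cdot> (|a|\<^sup>2 + |b|\<^sup>2) + \<i> a \<bullet> b) / s\<close>, see \<open>phase_real\<close> below; the definition expands the products
bilinearly, so that it makes sense, and is holomorphic, for all complex \<open>s \<noteq> 0\<close>. The first summand gives
decay at \<open>s = 1\<close>, where \<open>\<i> a \<bullet> b / s\<close> is purely imaginary. Its coefficient contains \<open>s + 1/s\<close> because
this vanishes at \<open>s = \<i>\<close>: there the phase is \<open>a \<bullet> b\<close>.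
\<close>

definition phase :: "('a::euclidean_space \<Rightarrow> 'a) \<Rightarrow> real \<Rightarrow> complex \<Rightarrow> 'a \<times> 'a \<Rightarrow> complex" where
  "phase T l s w = (let u = fst w; v = snd w; y = T u; z = T v in
     of_real l * (1 + 1 / s\<^sup>2) / 2 * of_real (u \<bullet> u + y \<bullet> y)
   + of_real l * (s\<^sup>2 + 1) / 2 * of_real (v \<bullet> v + z \<bullet> z)
   + of_real l * (s + 1 / s) * of_real (u \<bullet> v - y \<bullet> z)
   + \<i> / s * of_real (u \<bullet> y) + (- \<i> * s) * of_real (v \<bullet> z)
   + \<i> * of_real (v \<bullet> y - u \<bullet> z))"

locale monotone_map = abs_det jac
  for jac :: "('a::euclidean_space \<times> 'a \<Rightarrow> 'a \<times> 'a) \<Rightarrow> real" +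
  fixes T :: "'a \<Rightarrow> 'a" and T' :: "'a \<Rightarrow> 'a \<Rightarrow> 'a" and \<epsilon> C :: real
  assumes \<epsilon>: "0 < \<epsilon>" "\<epsilon> \<le> 1" and C: "1 \<le> C"
    and T_0: "T 0 = 0"
    and T_mono: "\<epsilon> * (norm (x - y))\<^sup>2 \<le> (T x - T y) \<bullet> (x - y)"
    and T_lip: "norm (T x - T y) \<le> C * norm (x - y)"
    and T_deriv: "(T has_derivative T' x) (at x)"
    and T'_cont: "continuous_on UNIV (\<lambda>x. T' x h)"
begin

definition pair_map :: "real \<Rightarrow> 'a \<times> 'a \<Rightarrow> 'a \<times> 'a" where
  "pair_map s w = (fst w + s *\<^sub>R snd w, T (fst w) - s *\<^sub>R T (snd w))"

definition pair_map' :: "real \<Rightarrow> 'a \<times> 'a \<Rightarrow> 'a \<times> 'a \<Rightarrow> 'a \<times> 'a" where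
  "pair_map' s w h = (fst h + s *\<^sub>R snd h, T' (fst w) (fst h) - s *\<^sub>R T' (snd w) (snd h))"

text \<open>
The Jacobian of \<open>pair_map 1\<close>. Weighting with it for every complex \<open>s\<close> is what makes the integral below
holomorphic: the Jacobian for real \<open>s\<close> differs from it by the factor \<open>stretch s\<close>, which does not involve \<open>T\<close>.
\<close>

definition pair_density :: "'a \<times> 'a \<Rightarrow> real" where "pair_density w = jac (pair_map' 1 w)"

definition stretch :: "real \<Rightarrow> real" where "stretch s = jac (\<lambda>h. (fst h, s *\<^sub>R snd h))"

text \<open>
Small enough for the indefinite cross term of the Gaussian part, of size at most \<open>2 damping C\<^sup>2 |w|\<^sup>2\<close>, to be
absorbed by half of \<open>u \<bullet> T u + v \<bullet> T v \<ge> \<epsilon> |w|\<^sup>2\<close>.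
\<close>

definition damping where "damping = \<epsilon> / (4 * C\<^sup>2)"

definition twisted_integral :: "complex \<Rightarrow> complex" where
  "twisted_integral s = (\<integral>w. pair_density w *\<^sub>R exp (- (phase T damping s w / 2)) \<partial>lborel)"

lemma T_cont: "continuous_on A T"
  using T_deriv by (meson continuous_at_imp_continuous_on has_derivative_continuous)

lemma T_measurable [measurable]: "T \<in> borel_measurable borel"
  by (intro borel_measurable_continuous_onI T_cont)

lemma T_linear: "linear (T' x)"
  using T_deriv has_derivative_linear by blast

lemma pair_map_deriv: "(pair_map s has_derivative pair_map' s w) (at w)"
proof -
  have "((\<lambda>w. T (fst w)) has_derivative (\<lambda>h. T' (fst w) (fst h))) (at w)"
    using diff_chain_at[OF has_derivative_fst[OF has_derivative_ident] T_deriv]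
    by (simp add: comp_def)
  moreover have "((\<lambda>w. T (snd w)) has_derivative (\<lambda>h. T' (snd w) (snd h))) (at w)"
    using diff_chain_at[OF has_derivative_snd[OF has_derivative_ident] T_deriv]
    by (simp add: comp_def)
  ultimately show ?thesis
    unfolding pair_map_def[abs_def] pair_map'_def[abs_def]
    by (intro derivative_intros) auto
qed

lemma pair_map'_cont: "continuous_on UNIV (\<lambda>w. pair_map' s w h)"
  unfolding pair_map'_def
  by (intro continuous_intros continuous_on_compose2[OF T'_cont]) auto

lemma pair_map_measurable [measurable]: "pair_map s \<in> borel_measurable borel"
  by (intro borel_measurable_continuous_onI continuous_at_imp_continuous_on ballI
      has_derivative_continuous[OF pair_map_deriv])

text \<open>
Eliminating \<open>v\<close> from \<open>u + s v = a\<close> and \<open>T u - s T v = b\<close> leaves one equation for \<open>u\<close> whose left-hand side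
\<open>T u - s T ((a - u) / s)\<close> is again strongly monotone.
\<close>

lemma pair_map_bij: assumes s: "0 < s" shows "bij (pair_map s)"
proof -
  define M where "M a x = T x - s *\<^sub>R T ((1/s) *\<^sub>R (a - x))" for a x
  have bijM: "bij (M a)" for a
  proof (rule strongly_monotone_lipschitz_bij)
    show "0 < \<epsilon>" by (rule \<epsilon>)
    fix x y
    let ?x = "(1/s) *\<^sub>R (a - x)" and ?y = "(1/s) *\<^sub>R (a - y)"
    have d: "x - y = - s *\<^sub>R (?x - ?y)" using s by (simp add: scaleR_diff_right[symmetric])
    have "(M a x - M a y) \<bullet> (x - y) = (T x - T y) \<bullet> (x - y) - s * ((T ?x - T ?y) \<bullet> (x - y))"
      by (simp add: M_def inner_diff_left inner_diff_right algebra_simps)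
    also have "(T ?x - T ?y) \<bullet> (x - y) = - s * ((T ?x - T ?y) \<bullet> (?x - ?y))"
      by (subst d) simp
    also have "(T x - T y) \<bullet> (x - y) - s * (- s * ((T ?x - T ?y) \<bullet> (?x - ?y)))
        = (T x - T y) \<bullet> (x - y) + s\<^sup>2 * ((T ?x - T ?y) \<bullet> (?x - ?y))"
      by (simp add: power2_eq_square)
    also have "\<dots> \<ge> \<epsilon> * (norm (x - y))\<^sup>2 + s\<^sup>2 * 0"
      using T_mono[of x y] T_mono[of ?x ?y] \<epsilon> by (intro add_mono mult_left_mono) (auto intro: order_trans[rotated])
    finally show "\<epsilon> * (norm (x - y))\<^sup>2 \<le> (M a x - M a y) \<bullet> (x - y)" by simp
    have "norm (M a x - M a y) = norm ((T x - T y) - s *\<^sub>R (T ?x - T ?y))"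
      by (simp add: M_def algebra_simps)
    also have "\<dots> \<le> norm (T x - T y) + norm (s *\<^sub>R (T ?x - T ?y))"
      by (rule norm_triangle_ineq4)
    also have "norm (s *\<^sub>R (T ?x - T ?y)) \<le> s * (C * norm (?x - ?y))"
      using s T_lip[of ?x ?y] by simp
    also have "s * (C * norm (?x - ?y)) = C * norm (x - y)"
      using s by (subst d) simp
    finally show "norm (M a x - M a y) \<le> (2 * C) * norm (x - y)"
      using T_lip[of x y] by simp
  qed
  show ?thesis
  proof (rule bijI')
    fix w w'
    have fibre: "T (fst w) - s *\<^sub>R T (snd w) = M a (fst w)" if "a = fst w + s *\<^sub>R snd w" for w a
      using s that by (simp add: M_def)
    show "pair_map s w = pair_map s w' \<longleftrightarrow> w = w'"
    proof
      assume eq: "pair_map s w = pair_map s w'"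
      define a where "a = fst w + s *\<^sub>R snd w"
      have a': "a = fst w' + s *\<^sub>R snd w'" using eq by (simp add: pair_map_def a_def)
      have "M a (fst w) = M a (fst w')"
        using eq fibre[OF a_def] fibre[OF a'] by (simp add: pair_map_def)
      then have "fst w = fst w'" using bijM[of a] by (simp add: bij_def inj_eq)
      then show "w = w'" using a' s by (simp add: a_def prod_eq_iff)
    qed simp
  next
    fix p :: "'a \<times> 'a"
    obtain u where u: "M (fst p) u = snd p" using bijM[of "fst p"] by (metis bij_pointE)
    have "pair_map s (u, (1/s) *\<^sub>R (fst p - u)) = p"
      using s u by (simp add: pair_map_def M_def prod_eq_iff)
    then show "\<exists>w. p = pair_map s w" by metis
  qed
qed

lemma linear_stretch: "linear (\<lambda>h::'a \<times> 'a. (fst h, s *\<^sub>R snd h))"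
  by (intro linearI) (auto simp: algebra_simps)

lemma stretch_pos: assumes "0 < s" shows "0 < stretch s"
proof -
  have "bij (\<lambda>h::'a \<times> 'a. (fst h, s *\<^sub>R snd h))"
    using assms
    by (intro o_bij[of "\<lambda>h. (fst h, (1/s) *\<^sub>R snd h)"]) (auto simp: fun_eq_iff)
  then show ?thesis unfolding stretch_def using linear_stretch jac_pos by blast
qed

text \<open>
By linearity of the derivative of \<open>T\<close>, the parameter \<open>s\<close> can be moved onto the increment of the second
argument: the derivative of \<open>pair_map s\<close> is that of \<open>pair_map 1\<close> after a stretching by \<open>s\<close>.
\<close>

lemma jac_pair_map': "jac (pair_map' s w) = stretch s * pair_density w"
proof -
  have "pair_map' s w = pair_map' 1 w \<circ> (\<lambda>h. (fst h, s *\<^sub>R snd h))"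
    using linear_scale[OF T_linear] by (auto simp: pair_map'_def fun_eq_iff)
  moreover have "linear (pair_map' 1 w)"
    using pair_map_deriv has_derivative_linear by blast
  ultimately show ?thesis
    using jac_compose[OF _ linear_stretch] by (simp add: stretch_def pair_density_def)
qed

lemma pair_density_nonneg: "0 \<le> pair_density w" by (simp add: pair_density_def jac_nonneg)

lemma pushforward:
  assumes "0 < s"
  shows "distr (density lborel (\<lambda>w. ennreal (stretch s * pair_density w))) borel (pair_map s) = lborel"
  using jac_change[OF pair_map_deriv pair_map'_cont pair_map_bij[OF assms]] by (simp add: jac_pair_map')

lemma pair_density_measurable [measurable]: "pair_density \<in> borel_measurable borel"
  using jac_change[OF pair_map_deriv pair_map'_cont pair_map_bij[of 1]] by (simp add: pair_density_def[abs_def])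

lemma stretch_1: "stretch 1 = 1"
proof -
  have "stretch 1 = jac id" by (simp add: stretch_def id_def)
  moreover have "jac (id \<circ> id) = jac id * jac id"
    by (intro jac_compose linear_id)
  ultimately show ?thesis using stretch_pos[of 1] by simp
qed

lemma nn_integral_pair_map:
  assumes [measurable]: "f \<in> borel_measurable borel" and s: "0 < s"
  shows "(\<integral>\<^sup>+p. f p \<partial>lborel) = (\<integral>\<^sup>+w. ennreal (stretch s * pair_density w) * f (pair_map s w) \<partial>lborel)"
proof -
  have "(\<integral>\<^sup>+p. f p \<partial>lborel) = (\<integral>\<^sup>+p. f p \<partial>distr (density lborel (\<lambda>w. ennreal (stretch s * pair_density w))) borel (pair_map s))"
    using pushforward[OF s] by simp
  also have "\<dots> = (\<integral>\<^sup>+w. f (pair_map s w) \<partial>density lborel (\<lambda>w. ennreal (stretch s * pair_density w)))"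
    by (subst nn_integral_distr) auto
  also have "\<dots> = (\<integral>\<^sup>+w. ennreal (stretch s * pair_density w) * f (pair_map s w) \<partial>lborel)"
    by (subst nn_integral_density) auto
  finally show ?thesis .
qed

lemma integral_pair_map:
  fixes f :: "'a \<times> 'a \<Rightarrow> complex"
  assumes [measurable]: "f \<in> borel_measurable borel" and s: "0 < s"
  shows "(\<integral>p. f p \<partial>lborel) = of_real (stretch s) * (\<integral>w. pair_density w *\<^sub>R f (pair_map s w) \<partial>lborel)"
proof -
  have "(\<integral>p. f p \<partial>lborel) = (\<integral>p. f p \<partial>distr (density lborel (\<lambda>w. ennreal (stretch s * pair_density w))) borel (pair_map s))"
    using pushforward[OF s] by simp
  also have "\<dots> = (\<integral>w. f (pair_map s w) \<partial>density lborel (\<lambda>w. ennreal (stretch s * pair_density w)))"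
    by (subst integral_distr) auto
  also have "\<dots> = (\<integral>w. (stretch s * pair_density w) *\<^sub>R f (pair_map s w) \<partial>lborel)"
    using stretch_pos[OF s] pair_density_nonneg by (subst integral_density) auto
  also have "\<dots> = of_real (stretch s) * (\<integral>w. pair_density w *\<^sub>R f (pair_map s w) \<partial>lborel)"
    by (simp add: scaleR_conv_of_real mult.assoc)
  finally show ?thesis .
qed

lemma T_coercive: "\<epsilon> * (norm x)\<^sup>2 \<le> x \<bullet> T x"
  using T_mono[of x 0] by (simp add: T_0 inner_commute)

lemma T_bound: "norm (T x) \<le> C * norm x"
  using T_lip[of x 0] by (simp add: T_0)

lemma T_bound_sq: "T x \<bullet> T x \<le> C\<^sup>2 * (norm x)\<^sup>2"
  using power_mono[OF T_bound[of x], of 2] by (simp add: power_mult_distrib power2_norm_eq_inner)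

lemma norm_sq_prod: "(norm w)\<^sup>2 = (norm (fst w))\<^sup>2 + (norm (snd w))\<^sup>2" for w :: "'a \<times> 'a"
  by (simp add: norm_prod_def)

lemma C_sq: "1 \<le> C\<^sup>2" "C \<le> C\<^sup>2"
  using C by (auto simp: power2_eq_square intro: order_trans)

lemma abs_inner_le: "\<bar>x \<bullet> y\<bar> \<le> ((norm x)\<^sup>2 + (norm y)\<^sup>2) / 2" for x y :: 'a
proof -
  have "\<bar>x \<bullet> y\<bar> \<le> norm x * norm y" by (rule Cauchy_Schwarz_ineq2)
  also have "\<dots> \<le> ((norm x)\<^sup>2 + (norm y)\<^sup>2) / 2"
    using sum_squares_bound[of "norm x" "norm y"] by simp
  finally show ?thesis .
qed

lemma quadratic_bounds:
  fixes w :: "'a \<times> 'a"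
  defines "u \<equiv> fst w" and "v \<equiv> snd w"
  shows "\<bar>u \<bullet> u + T u \<bullet> T u\<bar> \<le> 2 * C\<^sup>2 * (norm w)\<^sup>2"
    and "\<bar>v \<bullet> v + T v \<bullet> T v\<bar> \<le> 2 * C\<^sup>2 * (norm w)\<^sup>2"
    and "\<bar>u \<bullet> v - T u \<bullet> T v\<bar> \<le> C\<^sup>2 * (norm w)\<^sup>2"
    and "\<bar>u \<bullet> T u\<bar> \<le> C\<^sup>2 * (norm w)\<^sup>2"
    and "\<bar>v \<bullet> T v\<bar> \<le> C\<^sup>2 * (norm w)\<^sup>2"
proof -
  have N: "(norm w)\<^sup>2 = (norm u)\<^sup>2 + (norm v)\<^sup>2" by (simp add: norm_sq_prod u_def v_def)
  define U V where "U = (norm u)\<^sup>2" and "V = (norm v)\<^sup>2"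
  have nn: "0 \<le> U" "0 \<le> V" by (auto simp: U_def V_def)
  have m: "U \<le> C\<^sup>2 * U" "V \<le> C\<^sup>2 * V" "0 \<le> C\<^sup>2 * U" "0 \<le> C\<^sup>2 * V"
    using C_sq nn mult_right_mono[of 1 "C\<^sup>2"] by auto
  have Tsq: "(norm (T u))\<^sup>2 \<le> C\<^sup>2 * U" "(norm (T v))\<^sup>2 \<le> C\<^sup>2 * V"
    using T_bound_sq by (auto simp: U_def V_def power2_norm_eq_inner)
  have sq: "u \<bullet> u = U" "v \<bullet> v = V" "T u \<bullet> T u = (norm (T u))\<^sup>2" "T v \<bullet> T v = (norm (T v))\<^sup>2"
    by (simp_all add: U_def V_def power2_norm_eq_inner)
  have N': "C\<^sup>2 * (norm w)\<^sup>2 = C\<^sup>2 * U + C\<^sup>2 * V"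
    by (simp add: N U_def V_def algebra_simps)
  show "\<bar>u \<bullet> u + T u \<bullet> T u\<bar> \<le> 2 * C\<^sup>2 * (norm w)\<^sup>2" "\<bar>v \<bullet> v + T v \<bullet> T v\<bar> \<le> 2 * C\<^sup>2 * (norm w)\<^sup>2"
    unfolding sq mult.assoc N' using m Tsq nn by auto
  show "\<bar>u \<bullet> v - T u \<bullet> T v\<bar> \<le> C\<^sup>2 * (norm w)\<^sup>2"
    unfolding N' using m Tsq abs_inner_le[of u v] abs_inner_le[of "T u" "T v"]
    by (simp add: U_def V_def)
  show "\<bar>u \<bullet> T u\<bar> \<le> C\<^sup>2 * (norm w)\<^sup>2" "\<bar>v \<bullet> T v\<bar> \<le> C\<^sup>2 * (norm w)\<^sup>2"
    unfolding N' using m Tsq abs_inner_le[of u "T u"] abs_inner_le[of v "T v"] nn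
    by (simp_all add: U_def V_def)
qed

lemma phase_diff:
  "norm (phase T damping s w - phase T damping t w) \<le> 2 * C\<^sup>2 * (norm w)\<^sup>2 *
     (norm (of_real damping * (1 + 1 / s\<^sup>2) / 2 - of_real damping * (1 + 1 / t\<^sup>2) / 2)
    + norm (of_real damping * (s\<^sup>2 + 1) / 2 - of_real damping * (t\<^sup>2 + 1) / 2)
    + norm (of_real damping * (s + 1 / s) - of_real damping * (t + 1 / t))
    + norm (\<i> / s - \<i> / t) + norm (- \<i> * s - - \<i> * t))"
proof -
  have gen: "norm ((a1 * of_real q1 + a2 * of_real q2 + a3 * of_real q3 + a4 * of_real q4 + a5 * of_real q5 + c)
     - (b1 * of_real q1 + b2 * of_real q2 + b3 * of_real q3 + b4 * of_real q4 + b5 * of_real q5 + c))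
     \<le> B * (norm (a1 - b1) + norm (a2 - b2) + norm (a3 - b3) + norm (a4 - b4) + norm (a5 - b5))"
    if "\<bar>q1\<bar> \<le> B" "\<bar>q2\<bar> \<le> B" "\<bar>q3\<bar> \<le> B" "\<bar>q4\<bar> \<le> B" "\<bar>q5\<bar> \<le> B"
    for a1 a2 a3 a4 a5 b1 b2 b3 b4 b5 c :: complex and q1 q2 q3 q4 q5 B
  proof -
    have "norm ((a1 - b1) * of_real q1 + (a2 - b2) * of_real q2 + (a3 - b3) * of_real q3
        + (a4 - b4) * of_real q4 + (a5 - b5) * of_real q5)
      \<le> norm (a1 - b1) * B + norm (a2 - b2) * B + norm (a3 - b3) * B + norm (a4 - b4) * B + norm (a5 - b5) * B"
      using that
      by (intro norm_triangle_le add_mono) (auto simp: norm_mult intro!: mult_left_mono)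
    then show ?thesis by (simp add: algebra_simps)
  qed
  note q = quadratic_bounds[of w]
  have nn: "0 \<le> C\<^sup>2 * (norm w)\<^sup>2" by simp
  show ?thesis
    unfolding phase_def Let_def
    by (rule gen) (use q nn in linarith)+
qed

text \<open>
All coefficients of the phase are continuous in \<open>s\<close> and all the quadratic expressions in it are
\<open>O(|w|\<^sup>2)\<close>, so coercivity survives a small change of \<open>s\<close> with half the constant.
\<close>

lemma coercive_nearby:
  assumes s0: "s0 \<noteq> 0" and c: "0 < c" and coer: "\<And>w. c * (norm w)\<^sup>2 \<le> Re (phase T damping s0 w)"
  obtains r where "0 < r" "\<And>s w. s \<in> ball s0 r \<Longrightarrow> s \<noteq> 0 \<and> c / 2 * (norm w)\<^sup>2 \<le> Re (phase T damping s w)"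
proof -
  define \<Delta> where "\<Delta> s = norm (of_real damping * (1 + 1 / s\<^sup>2) / 2 - of_real damping * (1 + 1 / s0\<^sup>2) / 2)
    + norm (of_real damping * (s\<^sup>2 + 1) / 2 - of_real damping * (s0\<^sup>2 + 1) / 2)
    + norm (of_real damping * (s + 1 / s) - of_real damping * (s0 + 1 / s0))
    + norm (\<i> / s - \<i> / s0) + norm (- \<i> * s - - \<i> * s0)" for s
  have "isCont \<Delta> s0"
    unfolding \<Delta>_def using s0 by (intro continuous_intros) auto
  then have "(\<Delta> \<longlongrightarrow> \<Delta> s0) (nhds s0)"
    by (simp add: continuous_at tendsto_at_iff_tendsto_nhds)
  moreover have "\<Delta> s0 = 0" by (simp add: \<Delta>_def)
  moreover have "0 < c / (4 * C\<^sup>2)" using c C by simp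
  ultimately have "eventually (\<lambda>s. \<Delta> s < c / (4 * C\<^sup>2)) (nhds s0)"
    by (metis order_tendstoD(2))
  moreover have "eventually (\<lambda>s. s \<noteq> 0) (nhds s0)"
    using s0 by (rule t1_space_nhds)
  ultimately have "eventually (\<lambda>s. \<Delta> s < c / (4 * C\<^sup>2) \<and> s \<noteq> 0) (nhds s0)"
    by (rule eventually_conj)
  then obtain r where r: "0 < r" "\<And>s. dist s s0 < r \<Longrightarrow> \<Delta> s < c / (4 * C\<^sup>2) \<and> s \<noteq> 0"
    unfolding eventually_nhds_metric by blast
  show ?thesis
  proof (rule that[OF r(1)])
    fix s w assume "s \<in> ball s0 r"
    then have s: "\<Delta> s \<le> c / (4 * C\<^sup>2)" "s \<noteq> 0" using r(2)[of s] by (auto simp: dist_commute)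
    have "Re (phase T damping s0 w) - Re (phase T damping s w) \<le> norm (phase T damping s w - phase T damping s0 w)"
      using complex_Re_le_cmod[of "phase T damping s0 w - phase T damping s w"] by (simp add: norm_minus_commute)
    also have "\<dots> \<le> 2 * C\<^sup>2 * (norm w)\<^sup>2 * \<Delta> s"
      unfolding \<Delta>_def by (rule phase_diff)
    also have "\<dots> \<le> 2 * C\<^sup>2 * (norm w)\<^sup>2 * (c / (4 * C\<^sup>2))"
      by (intro mult_left_mono s) auto
    also have "\<dots> = c / 2 * (norm w)\<^sup>2" using C by (simp add: field_simps)
    finally show "s \<noteq> 0 \<and> c / 2 * (norm w)\<^sup>2 \<le> Re (phase T damping s w)"
      using coer[of w] s(2) by (simp add: field_simps)
  qed
qed

text \<open>
The map \<open>pair_map 1\<close> is bounded below: \<open>u \<bullet> T u + v \<bullet> T v\<close> is at least \<open>\<epsilon> |w|\<^sup>2\<close>, and it equals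
\<open>b \<bullet> u + T v \<bullet> a\<close> with \<open>a = u + v\<close> and \<open>b = T u - T v\<close>, which is small if \<open>a\<close> and \<open>b\<close> are.
\<close>

lemma transversal: "\<epsilon>\<^sup>2 / C\<^sup>2 * (norm w)\<^sup>2 \<le> (norm (fst w + snd w))\<^sup>2 + (norm (T (fst w) - T (snd w)))\<^sup>2"
proof -
  define u v where "u = fst w" and "v = snd w"
  define a b where "a = u + v" and "b = T u - T v"
  define N where "N = (norm w)\<^sup>2"
  have N: "N = (norm u)\<^sup>2 + (norm v)\<^sup>2" by (simp add: N_def norm_sq_prod u_def v_def)
  have nnN: "0 \<le> N" by (simp add: N_def)
  have "\<epsilon> * N \<le> u \<bullet> T u + v \<bullet> T v"
    using T_coercive[of u] T_coercive[of v] by (simp add: N algebra_simps)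
  also have "\<dots> = b \<bullet> u + T v \<bullet> a"
    by (simp add: a_def b_def inner_diff_left inner_diff_right inner_add_right inner_commute)
  also have "\<dots> \<le> norm b * norm u + (C * norm v) * norm a"
    by (intro add_mono order_trans[OF norm_cauchy_schwarz] mult_right_mono T_bound) auto
  finally have 1: "\<epsilon> * N \<le> norm b * norm u + (C * norm a) * norm v" by (simp add: mult_ac)
  have "(\<epsilon> * N)\<^sup>2 \<le> (norm b * norm u + (C * norm a) * norm v)\<^sup>2"
    using 1 \<epsilon> nnN by (intro power_mono) auto
  also have "\<dots> \<le> ((norm b)\<^sup>2 + (C * norm a)\<^sup>2) * ((norm u)\<^sup>2 + (norm v)\<^sup>2)"
    using zero_le_power2[of "norm b * norm v - (C * norm a) * norm u"]
    by (simp add: power2_eq_square algebra_simps)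
  also have "\<dots> \<le> (C\<^sup>2 * ((norm a)\<^sup>2 + (norm b)\<^sup>2)) * N"
    unfolding N[symmetric] using C_sq mult_right_mono[of 1 "C\<^sup>2" "(norm b)\<^sup>2"] nnN
    by (intro mult_right_mono) (auto simp: power_mult_distrib algebra_simps)
  finally have 2: "(\<epsilon>\<^sup>2 * N) * N \<le> (C\<^sup>2 * ((norm a)\<^sup>2 + (norm b)\<^sup>2)) * N"
    by (simp add: power2_eq_square mult_ac)
  have "\<epsilon>\<^sup>2 * N \<le> C\<^sup>2 * ((norm a)\<^sup>2 + (norm b)\<^sup>2)"
  proof (cases "N = 0")
    case False
    then show ?thesis using 2 nnN by simp
  qed auto
  then show ?thesis
    using C by (simp add: N_def[symmetric] a_def b_def u_def v_def field_simps)
qed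

lemma Re_phase_cis:
  "Re (phase T damping (cis \<theta>) w) = damping * (cos \<theta>)\<^sup>2 * ((norm (fst w + snd w))\<^sup>2 + (norm (T (fst w) - T (snd w)))\<^sup>2)
     + 2 * damping * (cos \<theta> * (1 - cos \<theta>)) * (fst w \<bullet> snd w - T (fst w) \<bullet> T (snd w))
     + sin \<theta> * (fst w \<bullet> T (fst w) + snd w \<bullet> T (snd w))"
proof -
  define u v where "u = fst w" and "v = snd w"
  have inv: "1 / cis \<theta> = cis (- \<theta>)" "\<i> / cis \<theta> = \<i> * cis (-\<theta>)" "1 / cis (2 * \<theta>) = cis (- (2 * \<theta>))" "(cis \<theta>)\<^sup>2 = cis (2 * \<theta>)"
    by (simp_all add: divide_inverse cis_inverse Complex.DeMoivre)
  have "Re (phase T damping (cis \<theta>) w) = damping * (1 + cos (2 * \<theta>)) / 2 * (u \<bullet> u + T u \<bullet> T u)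
     + damping * (cos (2 * \<theta>) + 1) / 2 * (v \<bullet> v + T v \<bullet> T v) + damping * (2 * cos \<theta>) * (u \<bullet> v - T u \<bullet> T v)
     + sin \<theta> * (u \<bullet> T u) + sin \<theta> * (v \<bullet> T v)"
    unfolding phase_def Let_def inv u_def[symmetric] v_def[symmetric]
    by simp
  also have "cos (2 * \<theta>) = 2 * (cos \<theta>)\<^sup>2 - 1" by (rule cos_double_cos)
  finally have Re: "Re (phase T damping (cis \<theta>) w) = damping * (cos \<theta>)\<^sup>2 * (u \<bullet> u + T u \<bullet> T u + v \<bullet> v + T v \<bullet> T v)
     + 2 * damping * cos \<theta> * (u \<bullet> v - T u \<bullet> T v) + sin \<theta> * (u \<bullet> T u + v \<bullet> T v)"
    by (simp add: algebra_simps)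
  have norms: "(norm (u + v))\<^sup>2 = u \<bullet> u + v \<bullet> v + 2 * (u \<bullet> v)"
    "(norm (T u - T v))\<^sup>2 = T u \<bullet> T u + T v \<bullet> T v - 2 * (T u \<bullet> T v)"
    by (simp_all add: power2_norm_eq_inner inner_add inner_diff inner_commute)
  show ?thesis
    unfolding u_def[symmetric] v_def[symmetric] Re norms
    by (simp add: algebra_simps power2_eq_square)
qed

lemma damping_pos: "0 < damping" using \<epsilon> C by (simp add: damping_def)

text \<open>
Along \<open>s = cis \<theta>\<close> two sources of decay take over from each other: the Gaussian part, with weight
\<open>cos\<^sup>2 \<theta>\<close>, is nondegenerate by \<open>transversal\<close>, and \<open>u \<bullet> T u + v \<bullet> T v\<close> comes with weight \<open>sin \<theta>\<close>. The
indefinite remainder of the Gaussian part has weight \<open>cos \<theta> (1 - cos \<theta>) \<le> sin \<theta>\<close> and is absorbed by the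
second one thanks to the choice of \<open>damping\<close>.
\<close>

lemma coercive_arc:
  assumes \<theta>: "0 \<le> \<theta>" "\<theta> \<le> pi / 2"
  shows "min (damping * (\<epsilon>\<^sup>2 / C\<^sup>2)) (\<epsilon> / 2) * (norm w)\<^sup>2 \<le> Re (phase T damping (cis \<theta>) w)"
proof -
  define N where "N = (norm w)\<^sup>2"
  define c s where "c = cos \<theta>" and "s = sin \<theta>"
  define \<kappa> where "\<kappa> = min (damping * (\<epsilon>\<^sup>2 / C\<^sup>2)) (\<epsilon> / 2)"
  have N: "0 \<le> N" by (simp add: N_def)
  have cs: "0 \<le> c" "0 \<le> s" "s \<le> 1" "c \<le> 1" "c\<^sup>2 + s\<^sup>2 = 1"
    using \<theta> by (auto simp: c_def s_def cos_ge_zero sin_ge_zero)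
  have s2: "s\<^sup>2 \<le> s" using cs by (simp add: power2_eq_square mult_left_le)
  have c2: "c\<^sup>2 \<le> c" using cs by (simp add: power2_eq_square mult_left_le)
  have "c * (1 - c) \<le> s" using s2 c2 cs by (simp add: algebra_simps power2_eq_square)
  have c1: "0 \<le> c * (1 - c)" using cs by simp
  define A where "A = (norm (fst w + snd w))\<^sup>2 + (norm (T (fst w) - T (snd w)))\<^sup>2"
  define Q where "Q = fst w \<bullet> snd w - T (fst w) \<bullet> T (snd w)"
  define P where "P = fst w \<bullet> T (fst w) + snd w \<bullet> T (snd w)"
  have A: "\<epsilon>\<^sup>2 / C\<^sup>2 * N \<le> A" unfolding A_def N_def by (rule transversal)
  have Q: "\<bar>Q\<bar> \<le> C\<^sup>2 * N" unfolding Q_def N_def by (rule quadratic_bounds)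
  have P: "\<epsilon> * N \<le> P"
    using T_coercive[of "fst w"] T_coercive[of "snd w"]
    by (simp add: P_def N_def norm_sq_prod algebra_simps)
  have lC: "2 * damping * (C\<^sup>2 * N) = \<epsilon> / 2 * N" using C by (simp add: damping_def field_simps)
  have "\<kappa> * N = \<kappa> * N * (c\<^sup>2 + s\<^sup>2)" using cs by simp
  also have "\<dots> \<le> damping * (\<epsilon>\<^sup>2 / C\<^sup>2) * N * c\<^sup>2 + \<epsilon> / 2 * N * s"
  proof -
    have "\<kappa> * N * c\<^sup>2 \<le> damping * (\<epsilon>\<^sup>2 / C\<^sup>2) * N * c\<^sup>2"
      using N by (intro mult_right_mono) (auto simp: \<kappa>_def)
    moreover have "\<kappa> * N * s\<^sup>2 \<le> \<epsilon> / 2 * N * s"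
      proof -
      have "\<kappa> * N \<le> \<epsilon> / 2 * N"
        using N unfolding \<kappa>_def by (intro mult_right_mono min.cobounded2)
      then show ?thesis by (rule mult_mono) (use N s2 \<epsilon> in auto)
    qed
    ultimately show ?thesis by (simp add: algebra_simps)
  qed
  also have "damping * (\<epsilon>\<^sup>2 / C\<^sup>2) * N * c\<^sup>2 \<le> damping * c\<^sup>2 * A"
    using mult_left_mono[OF A, of "damping * c\<^sup>2"] damping_pos by (simp add: mult_ac)
  also have "\<epsilon> / 2 * N * s \<le> 2 * damping * (c * (1 - c)) * Q + s * P"
  proof -
    have "- (2 * damping * (c * (1 - c)) * Q) = (2 * damping * (c * (1 - c))) * (- Q)" by simp
    also have "\<dots> \<le> (2 * damping * (c * (1 - c))) * \<bar>Q\<bar>"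
      using cs damping_pos by (intro mult_left_mono mult_nonneg_nonneg) auto
    also have "\<dots> = (c * (1 - c)) * (2 * damping * \<bar>Q\<bar>)" by (simp only: mult_ac)
    also have "\<dots> \<le> s * (2 * damping * (C\<^sup>2 * N))"
      using \<open>c * (1 - c) \<le> s\<close> c1 Q damping_pos N cs by (intro mult_mono) auto
    also have "\<dots> = s * (\<epsilon> / 2 * N)" by (simp only: lC)
    finally have "- (2 * damping * (c * (1 - c)) * Q) \<le> s * (\<epsilon> / 2 * N)" .
    moreover have "s * (\<epsilon> * N) \<le> s * P" using P cs by (intro mult_left_mono) auto
    ultimately show ?thesis by (simp add: field_simps)
  qed
  finally show ?thesis
    unfolding Re_phase_cis \<kappa>_def[symmetric] N_def[symmetric] A_def[symmetric] Q_def[symmetric] P_def[symmetric]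
      c_def[symmetric] s_def[symmetric] by simp
qed

text \<open>
Comparing with a Gaussian in \<open>pair_map 1 w\<close>, whose integral against \<open>pair_density\<close> is known by change of
variables, avoids any estimate of the determinant itself.
\<close>

lemma weight_integrable:
  assumes \<kappa>: "0 < \<kappa>"
  shows "integrable lborel (\<lambda>w. pair_density w * exp (- (\<kappa> * (norm w)\<^sup>2)))"
proof -
  define B where "B = 4 * C\<^sup>2"
  have B: "0 < B" using C by (simp add: B_def)
  have norm_pair_map: "(norm (pair_map 1 w))\<^sup>2 \<le> B * (norm w)\<^sup>2" for w
  proof -
    have "(norm (x + y))\<^sup>2 \<le> 2 * ((norm x)\<^sup>2 + (norm y)\<^sup>2)" for x y :: 'a
    proof -
      have "(norm (x + y))\<^sup>2 \<le> (norm x + norm y)\<^sup>2"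
        by (intro power_mono norm_triangle_ineq) auto
      also have "\<dots> \<le> 2 * ((norm x)\<^sup>2 + (norm y)\<^sup>2)"
        using sum_squares_bound[of "norm x" "norm y"] by (simp add: power2_sum)
      finally show ?thesis .
    qed
    note par = this
    have TT: "(norm (T x))\<^sup>2 \<le> C\<^sup>2 * (norm x)\<^sup>2" for x
      using T_bound_sq[of x] by (simp add: power2_norm_eq_inner)
    have CC: "(norm x)\<^sup>2 \<le> C\<^sup>2 * (norm x)\<^sup>2" for x :: 'a
      using C_sq mult_right_mono[of 1 "C\<^sup>2" "(norm x)\<^sup>2"] by simp
    show ?thesis
      using par[of "fst w" "snd w"] par[of "T (fst w)" "- T (snd w)"] TT[of "fst w"] TT[of "snd w"]
        CC[of "fst w"] CC[of "snd w"]
      by (simp add: norm_sq_prod pair_map_def B_def algebra_simps)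
  qed
  have "(\<integral>\<^sup>+w. ennreal (pair_density w * exp (- (\<kappa> * (norm w)\<^sup>2))) \<partial>lborel)
      \<le> (\<integral>\<^sup>+w. ennreal (stretch 1 * pair_density w) * ennreal (exp (- (\<kappa> / B * (norm (pair_map 1 w))\<^sup>2))) \<partial>lborel)"
  proof (rule nn_integral_mono)
    fix w
    have "\<kappa> / B * (norm (pair_map 1 w))\<^sup>2 \<le> \<kappa> * (norm w)\<^sup>2"
      using mult_left_mono[OF norm_pair_map[of w], of "\<kappa> / B"] B \<kappa> by simp
    then show "ennreal (pair_density w * exp (- (\<kappa> * (norm w)\<^sup>2)))
        \<le> ennreal (stretch 1 * pair_density w) * ennreal (exp (- (\<kappa> / B * (norm (pair_map 1 w))\<^sup>2)))"
      using pair_density_nonneg[of w] by (simp add: stretch_1 ennreal_mult[symmetric] ennreal_leI mult_left_mono)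
  qed
  also have "\<dots> = (\<integral>\<^sup>+p. ennreal (exp (- (\<kappa> / B * (norm (p::'a\<times>'a))\<^sup>2))) \<partial>lborel)"
    by (rule nn_integral_pair_map[symmetric]) auto
  also have "\<dots> < \<infinity>"
    using nn_integral_gaussian[of "\<kappa> / B", where 'b="'a \<times> 'a"] \<kappa> B by simp
  finally show ?thesis
    using pair_density_nonneg by (intro integrableI_nonneg) auto
qed

lemma phase_measurable [measurable]: "phase T damping s \<in> borel_measurable borel"
  unfolding phase_def[abs_def] Let_def
  by (intro borel_measurable_continuous_onI continuous_intros continuous_on_compose2[OF T_cont[of UNIV]]) auto

lemma phase_holomorphic: "0 \<notin> U \<Longrightarrow> (\<lambda>s. phase T damping s w) holomorphic_on U"
  unfolding phase_def Let_def by (intro holomorphic_intros) auto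

definition coercive_set :: "complex set" where
  "coercive_set = {s. s \<noteq> 0 \<and> (\<exists>c>0. \<forall>w. c * (norm w)\<^sup>2 \<le> Re (phase T damping s w))}"

lemma open_coercive_set: "open coercive_set"
  unfolding open_contains_ball
proof
  fix s0 assume "s0 \<in> coercive_set"
  then obtain c where c: "s0 \<noteq> 0" "0 < c" "\<And>w. c * (norm w)\<^sup>2 \<le> Re (phase T damping s0 w)"
    unfolding coercive_set_def by blast
  obtain r where "0 < r" "\<And>s w. s \<in> ball s0 r \<Longrightarrow> s \<noteq> 0 \<and> c / 2 * (norm w)\<^sup>2 \<le> Re (phase T damping s w)"
    using coercive_nearby[OF c] by blast
  moreover have "0 < c / 2" using c by simp
  ultimately show "\<exists>r>0. ball s0 r \<subseteq> coercive_set"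
    unfolding coercive_set_def by (intro exI[of _ r]) blast
qed

lemma arc_coercive: "0 \<le> \<theta> \<Longrightarrow> \<theta> \<le> pi / 2 \<Longrightarrow> cis \<theta> \<in> coercive_set"
  unfolding coercive_set_def using coercive_arc[of \<theta>] damping_pos \<epsilon> C
  by (auto intro!: exI[of _ "min (damping * (\<epsilon>\<^sup>2 / C\<^sup>2)) (\<epsilon> / 2)"])

text \<open>
Near each point the integrand is dominated by \<open>pair_density\<close> times a fixed Gaussian.
\<close>

lemma twisted_integral_holomorphic: "twisted_integral holomorphic_on coercive_set"
  unfolding twisted_integral_def[abs_def]
proof (rule holomorphic_on_integral)
  show "(\<lambda>s. pair_density w *\<^sub>R exp (- (phase T damping s w / 2))) holomorphic_on coercive_set" for w
    unfolding scaleR_conv_of_real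
    by (intro holomorphic_intros phase_holomorphic) (auto simp: coercive_set_def)
next
  fix s0 assume s0: "s0 \<in> coercive_set"
  then obtain c where c: "s0 \<noteq> 0" "0 < c" "\<And>w. c * (norm w)\<^sup>2 \<le> Re (phase T damping s0 w)"
    unfolding coercive_set_def by blast
  obtain r where r: "0 < r" "\<And>s w. s \<in> ball s0 r \<Longrightarrow> s \<noteq> 0 \<and> c / 2 * (norm w)\<^sup>2 \<le> Re (phase T damping s w)"
    using coercive_nearby[OF c] by blast
  obtain r' where r': "0 < r'" "ball s0 r' \<subseteq> coercive_set"
    using open_coercive_set s0 unfolding open_contains_ball by blast
  have "norm (pair_density w *\<^sub>R exp (- (phase T damping t w / 2))) \<le> pair_density w * exp (- (c / 4 * (norm w)\<^sup>2))"
    if "t \<in> ball s0 (min r r')" for t w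
    using r(2)[of t w] that pair_density_nonneg[of w] by (simp add: mult_left_mono)
  then show "\<exists>r>0. \<exists>g. integrable lborel g \<and> ball s0 r \<subseteq> coercive_set \<and>
      (\<forall>t\<in>ball s0 r. \<forall>w. norm (pair_density w *\<^sub>R exp (- (phase T damping t w / 2))) \<le> g w)"
    using r(1) r' weight_integrable[of "c / 4"] c(2)
    by (intro exI[of _ "min r r'"] exI[of _ "\<lambda>w. pair_density w * exp (- (c / 4 * (norm w)\<^sup>2))"] conjI ballI allI) auto
qed simp

lemma phase_real:
  assumes s: "0 < s"
  shows "phase T damping (of_real s) w = of_real (damping * (s + 1 / s) / (2 * s) * (norm (pair_map s w))\<^sup>2)
      + \<i> * of_real (fst (pair_map s w) \<bullet> snd (pair_map s w) / s)"
proof -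
  define u v where "u = fst w" and "v = snd w"
  have n: "(norm (pair_map s w))\<^sup>2 = (u \<bullet> u + T u \<bullet> T u) + s\<^sup>2 * (v \<bullet> v + T v \<bullet> T v) + 2 * s * (u \<bullet> v - T u \<bullet> T v)"
    unfolding norm_sq_prod power2_norm_eq_inner pair_map_def u_def v_def
    by (simp add: inner_add inner_diff inner_commute algebra_simps power2_eq_square)
  have Re: "damping * (s + 1 / s) / (2 * s) * (norm (pair_map s w))\<^sup>2 = damping * (1 + 1 / s\<^sup>2) / 2 * (u \<bullet> u + T u \<bullet> T u)
      + damping * (s\<^sup>2 + 1) / 2 * (v \<bullet> v + T v \<bullet> T v) + damping * (s + 1 / s) * (u \<bullet> v - T u \<bullet> T v)"
    unfolding n using s by (simp add: field_simps power2_eq_square)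
  have i: "fst (pair_map s w) \<bullet> snd (pair_map s w) = u \<bullet> T u - s\<^sup>2 * (v \<bullet> T v) + s * (v \<bullet> T u - u \<bullet> T v)"
    unfolding pair_map_def u_def v_def
    by (simp add: inner_add inner_diff inner_commute algebra_simps power2_eq_square)
  have Im: "fst (pair_map s w) \<bullet> snd (pair_map s w) / s = u \<bullet> T u / s - s * (v \<bullet> T v) + (v \<bullet> T u - u \<bullet> T v)"
    unfolding i using s by (simp add: field_simps power2_eq_square)
  show ?thesis
    unfolding Re Im phase_def Let_def u_def[symmetric] v_def[symmetric] by (simp add: algebra_simps)
qed

text \<open>
The right-hand side does not mention \<open>T\<close>. This is the source of all information about the integral.
\<close>

lemma twisted_integral_real:
  assumes s: "0 < s"
  shows "of_real (stretch s) * twisted_integral (of_real s)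
    = (\<integral>p. exp (- ((of_real (damping * (s + 1 / s) / (2 * s) * (norm (p::'a \<times> 'a))\<^sup>2) + \<i> * of_real (fst p \<bullet> snd p / s)) / 2)) \<partial>lborel)"
proof -
  define f :: "'a \<times> 'a \<Rightarrow> complex" where "f p = exp (- ((of_real (damping * (s + 1 / s) / (2 * s) * (norm p)\<^sup>2)
      + \<i> * of_real (fst p \<bullet> snd p / s)) / 2))" for p
  have "f \<in> borel_measurable borel"
    unfolding f_def using s by (intro borel_measurable_continuous_onI continuous_intros) auto
  from integral_pair_map[OF this s] show ?thesis
    unfolding twisted_integral_def phase_real[OF s] f_def ..
qed

lemma phase_i:
  "phase T damping \<i> w = of_real (fst w \<bullet> T (fst w) + snd w \<bullet> T (snd w))
      + \<i> * of_real (snd w \<bullet> T (fst w) - fst w \<bullet> T (snd w))"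
  unfolding phase_def Let_def by simp

lemma norm_twisted_integral_i:
  "norm (twisted_integral \<i>) \<le> (\<integral>w. pair_density w * exp (- ((fst w \<bullet> T (fst w) + snd w \<bullet> T (snd w)) / 2)) \<partial>lborel)"
proof -
  have "norm (twisted_integral \<i>) \<le> (\<integral>w. norm (pair_density w *\<^sub>R exp (- (phase T damping \<i> w / 2))) \<partial>lborel)"
    unfolding twisted_integral_def by (rule integral_norm_bound)
  also have "(\<lambda>w. norm (pair_density w *\<^sub>R exp (- (phase T damping \<i> w / 2))))
      = (\<lambda>w. pair_density w * exp (- ((fst w \<bullet> T (fst w) + snd w \<bullet> T (snd w)) / 2)))"
    using pair_density_nonneg by (auto simp: phase_i)
  finally show ?thesis .
qed

end

text \<open>
Both integrals are holomorphic on a connected open set that contains the arc from \<open>1\<close> to \<open>\<i>\<close> and agree on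
real arguments near \<open>1\<close>. The constants \<open>\<epsilon>\<close> and \<open>C\<close> have to be common to both maps because the Gaussian
part of the phase depends on them.
\<close>

lemma twisted_integral_i_eq:
  assumes "monotone_map jac T T' \<epsilon> C" and "monotone_map jac S S' \<epsilon> C"
  shows "monotone_map.twisted_integral jac T T' \<epsilon> C \<i> = monotone_map.twisted_integral jac S S' \<epsilon> C \<i>"
proof -
  interpret T: monotone_map jac T T' \<epsilon> C by fact
  interpret S: monotone_map jac S S' \<epsilon> C by fact
  define W where "W = T.coercive_set \<inter> S.coercive_set"
  define U where "U = connected_component_set W 1"
  have W: "open W" unfolding W_def by (intro open_Int T.open_coercive_set S.open_coercive_set)
  have arc: "cis ` {0..pi/2} \<subseteq> W"
    unfolding W_def using T.arc_coercive S.arc_coercive by auto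
  have "connected (cis ` {0..pi/2})"
    by (intro connected_continuous_image continuous_intros) auto
  then have arcU: "cis ` {0..pi/2} \<subseteq> U"
    unfolding U_def using arc by (intro connected_component_maximal) (auto intro!: image_eqI[of _ _ 0])
  have U: "open U" "connected U" "U \<subseteq> W"
    unfolding U_def using W by (auto intro: open_connected_component dest: connected_component_in)
  have one: "1 \<in> U" using arcU by (auto intro!: image_eqI[of _ _ 0])
  have i: "\<i> \<in> U" using arcU by (auto intro!: image_eqI[of _ _ "pi/2"])
  obtain r where r: "0 < r" "ball 1 r \<subseteq> U" using U(1) one unfolding open_contains_ball by blast
  define R where "R = complex_of_real ` {1<..<1 + r}"
  have dist_1: "dist 1 (complex_of_real t) = \<bar>t - 1\<bar>" for t
    using dist_of_real[of 1 t, where 'a = complex] by (simp add: dist_real_def abs_minus_commute)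
  have RU: "R \<subseteq> U"
    using r(2) by (auto simp: R_def dist_1 subset_iff)
  have "T.twisted_integral \<i> - S.twisted_integral \<i> = 0"
  proof (rule analytic_continuation[of "\<lambda>s. T.twisted_integral s - S.twisted_integral s" U R 1])
    show "(\<lambda>s. T.twisted_integral s - S.twisted_integral s) holomorphic_on U"
      using U(3) T.twisted_integral_holomorphic S.twisted_integral_holomorphic unfolding W_def
      by (intro holomorphic_intros) (auto intro: holomorphic_on_subset)
    show "1 islimpt R"
      unfolding islimpt_approachable
    proof (intro allI impI)
      fix e :: real assume e: "0 < e"
      define t where "t = min r e / 2"
      have "0 < t" "t < r" "t < e" using e r by (auto simp: t_def)
      then show "\<exists>x'\<in>R. x' \<noteq> 1 \<and> dist x' 1 < e"
        by (intro bexI[of _ "complex_of_real (1 + t)"]) (auto simp: R_def dist_commute[of _ 1] dist_1 simp del: of_real_add)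
    qed
    show "T.twisted_integral z - S.twisted_integral z = 0" if "z \<in> R" for z
    proof -
      obtain s where s: "z = of_real s" "0 < s" using \<open>z \<in> R\<close> by (auto simp: R_def)
      have "of_real (T.stretch s) * T.twisted_integral z = of_real (T.stretch s) * S.twisted_integral z"
        using T.twisted_integral_real[OF s(2)] S.twisted_integral_real[OF s(2)] by (simp add: s T.stretch_def S.stretch_def T.damping_def S.damping_def)
      then show ?thesis using T.stretch_pos[OF s(2)] by simp
    qed
  qed (use U one i RU in auto)
  then show ?thesis by simp
qed

lemma (in monotone_map) monotone_map_id: "monotone_map jac (\<lambda>x. x) (\<lambda>x h. h) \<epsilon> C"
proof unfold_locales
  fix x y :: 'a
  show "\<epsilon> * (norm (x - y))\<^sup>2 \<le> (x - y) \<bullet> (x - y)"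
    using \<epsilon> mult_right_mono[of \<epsilon> 1 "(norm (x - y))\<^sup>2"] by (simp add: power2_norm_eq_inner)
  show "norm (x - y) \<le> C * norm (x - y)"
    using C mult_right_mono[of 1 C "norm (x - y)"] by simp
qed (use \<epsilon> C in auto)

text \<open>
For the identity the imaginary part of the phase at \<open>\<i>\<close> cancels, and \<open>(u, v) \<mapsto> (u + v, u - v)\<close> doubles
the squared norm, so the integral becomes a real Gaussian one.
\<close>

lemma (in monotone_map) twisted_integral_i_id: "monotone_map.twisted_integral jac (\<lambda>x. x) (\<lambda>x h. h) \<epsilon> C \<i> = of_real ((4 * pi) ^ DIM('a))"
proof -
  interpret I: monotone_map jac "\<lambda>x. x" "\<lambda>x h. h" \<epsilon> C by (rule monotone_map_id)
  define f :: "'a \<times> 'a \<Rightarrow> complex" where "f p = exp (of_real (- (1/4 * (norm p)\<^sup>2)))" for p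
  have "(\<integral>\<^sup>+p. ennreal (exp (- (1/4 * (norm p)\<^sup>2))) \<partial>(lborel :: ('a \<times> 'a) measure)) = ennreal ((4 * pi) ^ DIM('a))"
  proof -
    have "sqrt (4 * pi) ^ (DIM('a) + DIM('a)) = (4 * pi) ^ DIM('a)"
      by (simp only: power_add power_mult_distrib[symmetric] real_sqrt_mult_self) simp
    then show ?thesis
      using nn_integral_gaussian[of "1/4", where 'b = "'a \<times> 'a"] by (simp add: mult.commute)
  qed
  then have int: "(\<integral>p. exp (- (1/4 * (norm p)\<^sup>2)) \<partial>(lborel :: ('a \<times> 'a) measure)) = (4 * pi) ^ DIM('a)"
    by (intro integral_eq_nn_integral[THEN trans]) auto
  have "I.twisted_integral \<i> = (\<integral>w. I.pair_density w *\<^sub>R f (I.pair_map 1 w) \<partial>lborel)"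
    unfolding I.twisted_integral_def
  proof (intro Bochner_Integration.integral_cong refl)
    fix w :: "'a \<times> 'a"
    have "(norm (I.pair_map 1 w))\<^sup>2 = 2 * (fst w \<bullet> fst w + snd w \<bullet> snd w)"
      by (simp add: I.norm_sq_prod I.pair_map_def power2_norm_eq_inner inner_add inner_diff inner_commute)
    then have "f (I.pair_map 1 w) = exp (- (of_real (fst w \<bullet> fst w + snd w \<bullet> snd w) / 2))"
      unfolding f_def by (intro arg_cong[where f = exp]) simp
    then show "I.pair_density w *\<^sub>R exp (- (phase (\<lambda>x. x) I.damping \<i> w / 2)) = I.pair_density w *\<^sub>R f (I.pair_map 1 w)"
      by (simp add: I.phase_i inner_commute)
  qed
  also have "\<dots> = (\<integral>p. f p \<partial>lborel)"
  proof -
    have "f \<in> borel_measurable borel"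
      unfolding f_def by (intro borel_measurable_continuous_onI continuous_intros)
    from I.integral_pair_map[OF this, of 1] show ?thesis by (simp add: I.stretch_1)
  qed
  also have "\<dots> = of_real ((4 * pi) ^ DIM('a))"
    unfolding f_def exp_of_real integral_complex_of_real int ..
  finally show ?thesis .
qed

text \<open>
At \<open>s = \<i>\<close> the modulus of the integrand is \<open>pair_density\<close> times the weight below; pushing forward along
\<open>pair_map 1\<close> turns a pointwise bound of this weight into a bound for an ordinary integral.
\<close>

lemma (in monotone_map) weighted_volume_bound:
  assumes [measurable]: "\<Psi> \<in> borel_measurable borel"
    and le: "\<And>u v. ennreal (exp (- ((u \<bullet> T u + v \<bullet> T v) / 2))) \<le> \<Psi> (u + v, T u - T v)"
  shows "ennreal ((4 * pi) ^ DIM('a)) \<le> (\<integral>\<^sup>+p. \<Psi> p \<partial>lborel)"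
proof -
  define g where "g w = pair_density w * exp (- ((fst w \<bullet> T (fst w) + snd w \<bullet> T (snd w)) / 2))" for w
  have [measurable]: "(\<lambda>w. exp (- ((fst w \<bullet> T (fst w) + snd w \<bullet> T (snd w)) / 2))) \<in> borel_measurable borel"
    by (intro borel_measurable_continuous_onI continuous_intros continuous_on_compose2[OF T_cont[of UNIV]]) auto
  have g_meas: "g \<in> borel_measurable borel" unfolding g_def by measurable
  have gnn: "0 \<le> g w" for w by (simp add: g_def pair_density_nonneg)
  have int: "integrable lborel g"
  proof (rule Bochner_Integration.integrable_bound[OF weight_integrable[of "\<epsilon> / 2"]])
    have "\<epsilon> * (norm w)\<^sup>2 \<le> fst w \<bullet> T (fst w) + snd w \<bullet> T (snd w)" for w
      using T_coercive[of "fst w"] T_coercive[of "snd w"] by (simp add: norm_sq_prod algebra_simps)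
    then show "AE w in lborel. norm (g w) \<le> norm (pair_density w * exp (- (\<epsilon> / 2 * (norm w)\<^sup>2)))"
      by (intro AE_I2) (simp add: g_def pair_density_nonneg mult_left_mono)
  qed (use \<epsilon> g_meas in auto)
  have "(4 * pi) ^ DIM('a) = norm (twisted_integral \<i>)"
    unfolding twisted_integral_i_eq[OF monotone_map_axioms monotone_map_id] twisted_integral_i_id by (simp only: norm_of_real) simp
  also have "\<dots> \<le> (\<integral>w. g w \<partial>lborel)" unfolding g_def by (rule norm_twisted_integral_i)
  finally have "ennreal ((4 * pi) ^ DIM('a)) \<le> ennreal (\<integral>w. g w \<partial>lborel)"
    by (rule ennreal_leI)
  also have "\<dots> = (\<integral>\<^sup>+w. ennreal (g w) \<partial>lborel)"
    using int gnn by (simp add: nn_integral_eq_integral)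
  also have "\<dots> \<le> (\<integral>\<^sup>+w. ennreal (stretch 1 * pair_density w) * \<Psi> (pair_map 1 w) \<partial>lborel)"
  proof (rule nn_integral_mono)
    fix w
    have "ennreal (g w) = ennreal (pair_density w) * ennreal (exp (- ((fst w \<bullet> T (fst w) + snd w \<bullet> T (snd w)) / 2)))"
      unfolding g_def by (intro ennreal_mult pair_density_nonneg) simp
    also have "\<dots> \<le> ennreal (pair_density w) * \<Psi> (fst w + snd w, T (fst w) - T (snd w))"
      by (intro mult_left_mono le) simp
    finally show "ennreal (g w) \<le> ennreal (stretch 1 * pair_density w) * \<Psi> (pair_map 1 w)"
      by (simp add: stretch_1 pair_map_def)
  qed
  also have "\<dots> = (\<integral>\<^sup>+p. \<Psi> p \<partial>lborel)"
    using nn_integral_pair_map[OF assms(1), of 1] by simp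
  finally show ?thesis .
qed

text \<open>
The form in which the complex argument is used for convex bodies: no determinant and no complex number
is left. The index type \<open>'n bit0\<close> in the proof only serves to give \<open>\<real>\<^sup>n \<times> \<real>\<^sup>n\<close> coordinates.
\<close>

theorem monotone_graph_volume_bound:
  fixes T :: "real^'n \<Rightarrow> real^'n"
  assumes e: "0 < e" and T_0: "T 0 = 0"
    and mono: "\<And>x y. e * (norm (x - y))\<^sup>2 \<le> (T x - T y) \<bullet> (x - y)"
    and lip: "\<And>x y. norm (T x - T y) \<le> L * norm (x - y)"
    and der: "\<And>x. (T has_derivative T' x) (at x)" and cont: "\<And>h. continuous_on UNIV (\<lambda>x. T' x h)"
    and meas: "\<Psi> \<in> borel_measurable borel"
    and le: "\<And>u v. ennreal (exp (- ((u \<bullet> T u + v \<bullet> T v) / 2))) \<le> \<Psi> (u + v, T u - T v)"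
  shows "ennreal ((4 * pi) ^ CARD('n)) \<le> (\<integral>\<^sup>+p. \<Psi> p \<partial>lborel)"
proof -
  have card: "CARD('n bit0) = DIM((real^'n) \<times> (real^'n))" by simp
  obtain jac :: "((real^'n) \<times> (real^'n) \<Rightarrow> (real^'n) \<times> (real^'n)) \<Rightarrow> real" where jac: "abs_det jac"
    using jacobian_functional[OF card] by metis
  have "monotone_map jac T T' (min e 1) (max L 1)"
  proof (intro monotone_map.intro jac monotone_map_axioms.intro)
    show "min e 1 * (norm (x - y))\<^sup>2 \<le> (T x - T y) \<bullet> (x - y)" for x y
      using mono[of x y] mult_right_mono[of "min e 1" e "(norm (x - y))\<^sup>2"] by simp
    show "norm (T x - T y) \<le> max L 1 * norm (x - y)" for x y
      using lip[of x y] mult_right_mono[of L "max L 1" "norm (x - y)"] by simp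
  qed (use e T_0 der cont in auto)
  from monotone_map.weighted_volume_bound[OF this meas le] show ?thesis by simp
qed

section \<open>Log-sum-exp approximation of a support function\<close>

text \<open>
For a finite set \<open>S\<close> and large \<open>p\<close>, the function \<open>ln (\<Sum>y\<in>S. exp (p (x \<bullet> y))) / p\<close> is a smooth convex
approximation of the support function \<open>Max {x \<bullet> y | y \<in> S}\<close>. Its gradient at \<open>x\<close> is the mean of \<open>S\<close> under the
probability weights proportional to \<open>exp (p (x \<bullet> y))\<close>, and the derivative of that mean is \<open>p\<close> times a
covariance.
\<close>

locale soft_maximum =
  fixes S :: "'a::euclidean_space set" and p :: real
  assumes S: "finite S" "S \<noteq> {}" and p: "0 < p"
begin

definition Z :: "'a \<Rightarrow> real" where "Z x = (\<Sum>y\<in>S. exp (p * (x \<bullet> y)))"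

definition softmax :: "'a \<Rightarrow> real" where "softmax x = ln (Z x) / p"

definition weight :: "'a \<Rightarrow> 'a \<Rightarrow> real" where "weight x y = exp (p * (x \<bullet> y)) / Z x"

definition mean :: "'a \<Rightarrow> 'a" where "mean x = (\<Sum>y\<in>S. weight x y *\<^sub>R y)"

definition mean' :: "'a \<Rightarrow> 'a \<Rightarrow> 'a" where
  "mean' x h = (\<Sum>y\<in>S. (p * weight x y * (h \<bullet> y - h \<bullet> mean x)) *\<^sub>R y)"

lemma Z_pos: "0 < Z x"
  unfolding Z_def using S by (intro sum_pos) auto

lemma weight_nonneg: "0 \<le> weight x y"
  using Z_pos[of x] by (simp add: weight_def)

lemma sum_weight: "(\<Sum>y\<in>S. weight x y) = 1"
  using Z_pos[of x] by (simp add: weight_def sum_divide_distrib[symmetric] Z_def[symmetric])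

lemma inner_mean: "h \<bullet> mean x = (\<Sum>y\<in>S. weight x y * (h \<bullet> y))"
  by (simp add: mean_def inner_sum_right)

text \<open>
A convex function lies above its tangents; here this is Jensen's inequality for the exponential,
obtained from \<open>1 + t \<le> exp t\<close> at deviations \<open>t\<close> from the mean.
\<close>

lemma softmax_tangent: "softmax u + (x - u) \<bullet> mean u \<le> softmax x"
proof -
  define m where "m = (x - u) \<bullet> mean u"
  have "Z u * (1 + 0) = Z u * (\<Sum>y\<in>S. weight u y * (1 + p * ((x - u) \<bullet> y - m)))"
  proof -
    have "(\<Sum>y\<in>S. weight u y * (1 + p * ((x - u) \<bullet> y - m)))
        = (1 - p * m) * (\<Sum>y\<in>S. weight u y) + p * (\<Sum>y\<in>S. weight u y * ((x - u) \<bullet> y))"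
      by (simp add: sum_distrib_left sum.distrib[symmetric] algebra_simps)
    then show ?thesis by (simp add: sum_weight m_def inner_mean)
  qed
  also have "\<dots> \<le> Z u * (\<Sum>y\<in>S. weight u y * exp (p * ((x - u) \<bullet> y - m)))"
    using Z_pos[of u] by (intro mult_left_mono sum_mono weight_nonneg exp_ge_add_one_self) auto
  also have "\<dots> = exp (- (p * m)) * Z x"
    using Z_pos[of u]
    by (simp add: weight_def Z_def[of x] sum_distrib_left exp_add[symmetric] algebra_simps)
  finally have "exp (p * m) * Z u \<le> exp (p * m) * (exp (- (p * m)) * Z x)"
    by (intro mult_left_mono) auto
  also have "\<dots> = Z x" by (simp add: exp_minus)
  finally have "ln (exp (p * m) * Z u) \<le> ln (Z x)"
    using Z_pos[of u] Z_pos[of x] by simp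
  then have "p * m + ln (Z u) \<le> ln (Z x)"
    using Z_pos[of u] by (simp add: ln_mult)
  then have "(p * m + ln (Z u)) / p \<le> ln (Z x) / p"
    using p by (intro divide_right_mono) auto
  then show ?thesis
    using p by (simp add: softmax_def m_def add_divide_distrib)
qed

lemma mean_mono: "0 \<le> (mean x - mean y) \<bullet> (x - y)"
  using softmax_tangent[of x y] softmax_tangent[of y x]
  by (simp add: inner_diff inner_commute algebra_simps)

lemma softmax_ge: assumes "y \<in> S" shows "x \<bullet> y \<le> softmax x"
proof -
  have "exp (p * (x \<bullet> y)) \<le> Z x"
    unfolding Z_def using S assms by (intro member_le_sum) auto
  then have "p * (x \<bullet> y) \<le> ln (Z x)" using Z_pos[of x] by (simp add: ln_ge_iff)
  then show ?thesis using p by (simp add: softmax_def field_simps)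
qed

lemma softmax_le:
  assumes "\<And>y. y \<in> S \<Longrightarrow> x \<bullet> y \<le> M"
  shows "softmax x \<le> M + ln (real (card S)) / p"
proof -
  have card: "0 < card S" using S by (simp add: card_gt_0_iff)
  have "Z x \<le> (\<Sum>y\<in>S. exp (p * M))"
    unfolding Z_def using assms p by (intro sum_mono) auto
  also have "\<dots> = real (card S) * exp (p * M)" by simp
  finally have "ln (Z x) \<le> ln (real (card S) * exp (p * M))"
    using Z_pos[of x] by (simp add: ln_le_cancel_iff card mult_pos_pos)
  also have "\<dots> = ln (real (card S)) + p * M" using card by (simp add: ln_mult)
  finally show ?thesis using p by (simp add: softmax_def field_simps)
qed

lemma Z_deriv: "(Z has_derivative (\<lambda>h. p * Z x * (h \<bullet> mean x))) (at x)"
proof -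
  have "(Z has_derivative (\<lambda>h. \<Sum>y\<in>S. exp (p * (x \<bullet> y)) * (p * (h \<bullet> y)))) (at x)"
    unfolding Z_def[abs_def] by (auto intro!: derivative_eq_intros simp: mult_ac)
  moreover have "(\<Sum>y\<in>S. exp (p * (x \<bullet> y)) * (p * (h \<bullet> y))) = p * Z x * (h \<bullet> mean x)" for h
    using Z_pos[of x] by (simp add: inner_mean weight_def sum_distrib_left mult_ac)
  ultimately show ?thesis by simp
qed

lemma weight_deriv: "((\<lambda>x. weight x y) has_derivative (\<lambda>h. p * weight x y * (h \<bullet> y - h \<bullet> mean x))) (at x)"
proof -
  have "Z x \<noteq> 0" using Z_pos[of x] by simp
  then have "((\<lambda>x. weight x y) has_derivative
      (\<lambda>h. - exp (p * (x \<bullet> y)) * (inverse (Z x) * (p * Z x * (h \<bullet> mean x)) * inverse (Z x)) + exp (p * (x \<bullet> y)) * (p * (h \<bullet> y)) / Z x)) (at x)"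
    unfolding weight_def
    by (intro has_derivative_divide Z_deriv) (auto intro!: derivative_eq_intros)
  moreover have "(\<lambda>h. - exp (p * (x \<bullet> y)) * (inverse (Z x) * (p * Z x * (h \<bullet> mean x)) * inverse (Z x)) + exp (p * (x \<bullet> y)) * (p * (h \<bullet> y)) / Z x)
      = (\<lambda>h. p * weight x y * (h \<bullet> y - h \<bullet> mean x))"
    using \<open>Z x \<noteq> 0\<close> by (auto simp: weight_def field_simps)
  ultimately show ?thesis by simp
qed

lemma mean_deriv: "(mean has_derivative mean' x) (at x)"
  unfolding mean_def[abs_def] mean'_def[abs_def]
  by (auto intro!: derivative_eq_intros weight_deriv simp: mean_def)

lemma mean_cont: "continuous_on A mean"
  using mean_deriv by (meson continuous_at_imp_continuous_on has_derivative_continuous)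

lemma mean'_cont: "continuous_on UNIV (\<lambda>x. mean' x h)"
  unfolding mean'_def weight_def
  using Z_pos Z_deriv
  by (intro continuous_intros mean_cont)
     (auto intro!: continuous_at_imp_continuous_on dest: has_derivative_continuous simp: less_imp_neq[symmetric])

lemma norm_mean_le: assumes "\<And>y. y \<in> S \<Longrightarrow> norm y \<le> R" shows "norm (mean x) \<le> R"
proof -
  have "norm (mean x) \<le> (\<Sum>y\<in>S. weight x y * R)"
    unfolding mean_def using assms weight_nonneg
    by (intro sum_norm_le) (auto intro!: mult_left_mono)
  also have "\<dots> = R" by (simp add: sum_weight sum_distrib_right[symmetric])
  finally show ?thesis .
qed

lemma mean_lipschitz:
  assumes R: "\<And>y. y \<in> S \<Longrightarrow> norm y \<le> R"
  shows "norm (mean x - mean y) \<le> 2 * p * R\<^sup>2 * norm (x - y)"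
proof (rule differentiable_bound[of UNIV mean mean'])
  fix x
  have R0: "0 \<le> R" using R S norm_ge_zero order_trans by blast
  show "onorm (mean' x) \<le> 2 * p * R\<^sup>2"
  proof (rule onorm_le)
    fix h
    have "norm (mean' x h) \<le> (\<Sum>y\<in>S. weight x y * (2 * p * R\<^sup>2 * norm h))"
      unfolding mean'_def
    proof (rule sum_norm_le)
      fix y assume y: "y \<in> S"
      have "\<bar>h \<bullet> y - h \<bullet> mean x\<bar> \<le> norm h * norm (y - mean x)"
        using Cauchy_Schwarz_ineq2[of h "y - mean x"] by (simp add: inner_diff_right)
      also have "\<dots> \<le> norm h * (2 * R)"
        using R[OF y] norm_mean_le[OF R, of x] norm_triangle_ineq4[of y "mean x"]
        by (intro mult_left_mono) auto
      finally have 1: "\<bar>h \<bullet> y - h \<bullet> mean x\<bar> \<le> norm h * (2 * R)" .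
      have "norm ((p * weight x y * (h \<bullet> y - h \<bullet> mean x)) *\<^sub>R y)
          = p * weight x y * (\<bar>h \<bullet> y - h \<bullet> mean x\<bar> * norm y)"
        using p weight_nonneg[of x y] by (simp add: abs_mult mult.assoc)
      also have "\<dots> \<le> p * weight x y * ((norm h * (2 * R)) * R)"
        using p weight_nonneg[of x y] 1 R[OF y] R0 by (intro mult_left_mono mult_mono) auto
      also have "\<dots> = weight x y * (2 * p * R\<^sup>2 * norm h)" by (simp add: power2_eq_square)
      finally show "norm ((p * weight x y * (h \<bullet> y - h \<bullet> mean x)) *\<^sub>R y) \<le> weight x y * (2 * p * R\<^sup>2 * norm h)" .
    qed
    also have "\<dots> = 2 * p * R\<^sup>2 * norm h" by (simp add: sum_weight sum_distrib_right[symmetric])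
    finally show "norm (mean' x h) \<le> 2 * p * R\<^sup>2 * norm h" .
  qed
qed (auto intro: mean_deriv has_derivative_at_withinI)

lemma mean_0: assumes "uminus ` S = S" shows "mean 0 = 0"
proof -
  have "(\<Sum>y\<in>S. y) = (\<Sum>y\<in>uminus ` S. y)" using assms by simp
  also have "\<dots> = - (\<Sum>y\<in>S. y)" by (subst sum.reindex) (auto simp: sum_negf)
  finally have "2 *\<^sub>R (\<Sum>y\<in>S. y) = 0" by (simp add: scaleR_2 eq_neg_iff_add_eq_0)
  then show ?thesis
    by (simp add: mean_def weight_def scaleR_sum_right[symmetric])
qed

end

section \<open>Support functions and polar bodies\<close>

definition support :: "'a::euclidean_space set \<Rightarrow> 'a \<Rightarrow> real" where
  "support A x = (SUP y\<in>A. x \<bullet> y)"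

context
  fixes A :: "'a::euclidean_space set"
  assumes A: "compact A" "A \<noteq> {}"
begin

lemma support_attained: "\<exists>y\<in>A. support A x = x \<bullet> y \<and> (\<forall>z\<in>A. x \<bullet> z \<le> x \<bullet> y)"
proof -
  obtain y where "y \<in> A" "\<forall>z\<in>A. x \<bullet> z \<le> x \<bullet> y"
    using continuous_attains_sup[OF A, of "\<lambda>y. x \<bullet> y"] continuous_on_inner[OF continuous_on_const continuous_on_id]
    by blast
  then show ?thesis
    unfolding support_def by (intro bexI[of _ y] conjI cSup_eq_maximum) auto
qed

lemma support_ge: "y \<in> A \<Longrightarrow> x \<bullet> y \<le> support A x"
  using support_attained[of x] by auto

lemma support_le_iff: "support A x \<le> t \<longleftrightarrow> (\<forall>y\<in>A. x \<bullet> y \<le> t)"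
  using support_attained[of x] by (metis order_trans)

lemma support_scale: assumes "0 \<le> t" shows "support A (t *\<^sub>R x) = t * support A x"
proof (rule antisym)
  show "support A (t *\<^sub>R x) \<le> t * support A x"
    using assms support_ge[of _ x] by (simp add: support_le_iff mult_left_mono)
  obtain y where "y \<in> A" "support A x = x \<bullet> y" using support_attained[of x] by blast
  then show "t * support A x \<le> support A (t *\<^sub>R x)"
    using support_ge[of y "t *\<^sub>R x"] by simp
qed

lemma support_add: "support A (x + y) \<le> support A x + support A y"
  using support_ge by (simp add: support_le_iff inner_add_left add_mono)

lemma support_uminus: assumes "uminus ` A = A" shows "support A (- x) = support A x"
proof -
  have "support A (- x) \<le> support A x" for x
    unfolding support_le_iff
  proof
    fix y assume "y \<in> A"
    then have "- y \<in> A" using assms by blast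
    then show "- x \<bullet> y \<le> support A x" using support_ge[of "- y" x] by simp
  qed
  from this[of x] this[of "- x"] show ?thesis by simp
qed

lemma support_nonneg: "0 \<in> A \<Longrightarrow> 0 \<le> support A x"
  using support_ge[of 0 x] by simp

lemma support_measurable: "support A \<in> borel_measurable borel"
proof (rule borel_measurableI_le)
  fix t
  have "{x. support A x \<le> t} = (\<Inter>y\<in>A. {x. x \<bullet> y \<le> t})"
    by (auto simp: support_le_iff)
  also have "closed \<dots>"
    by (intro closed_INT ballI closed_Collect_le continuous_intros)
  finally show "{x \<in> space borel. support A x \<le> t} \<in> sets borel" by simp
qed

end

lemma polar_eq_support: "compact K \<Longrightarrow> K \<noteq> {} \<Longrightarrow> polar K = {y. support K y \<le> 1}"
  by (auto simp: polar_def support_le_iff inner_commute)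

text \<open>
The nontrivial half of the bipolar theorem: a hyperplane that strictly separates \<open>x\<close> from \<open>K\<close>
misses the origin and can be normalised to a point of the polar.
\<close>

lemma bipolar_subset:
  assumes "closed K" "convex K" "0 \<in> K" and x: "\<And>y. y \<in> polar K \<Longrightarrow> x \<bullet> y \<le> 1"
  shows "x \<in> K"
proof (rule ccontr)
  assume "x \<notin> K"
  then obtain a b where ab: "a \<bullet> x < b" "\<And>z. z \<in> K \<Longrightarrow> b < a \<bullet> z"
    using separating_hyperplane_closed_point[OF assms(2,1)] by blast
  have b: "b < 0" using ab(2)[OF assms(3)] by simp
  have "(1/b) *\<^sub>R a \<in> polar K"
    unfolding polar_def
  proof safe
    fix z assume "z \<in> K"
    then have "b \<le> a \<bullet> z" using ab(2) by force
    then show "z \<bullet> ((1/b) *\<^sub>R a) \<le> 1" using b by (simp add: inner_commute[of z])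
  qed
  then have "x \<bullet> ((1/b) *\<^sub>R a) \<le> 1" by (rule x)
  then show False using ab(1) b by (simp add: inner_commute[of x] divide_le_eq)
qed

lemma polar_closed: "closed (polar K)"
proof -
  have "polar K = (\<Inter>x\<in>K. {y. x \<bullet> y \<le> 1})" by (auto simp: polar_def)
  then show ?thesis by (simp only:) (intro closed_INT ballI closed_Collect_le continuous_intros)
qed

lemma cball_subset_polar:
  fixes K :: "'a::euclidean_space set"
  assumes "K \<subseteq> cball 0 R" "0 < R" shows "cball 0 (1/R) \<subseteq> polar K"
proof
  fix y :: 'a assume y: "y \<in> cball 0 (1/R)"
  show "y \<in> polar K" unfolding polar_def
  proof safe
    fix x assume "x \<in> K"
    then have "norm x * norm y \<le> R * (1/R)"
      using assms y by (intro mult_mono) auto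
    then show "x \<bullet> y \<le> 1" using norm_cauchy_schwarz[of x y] assms by simp
  qed
qed

lemma polar_subset_cball:
  fixes K :: "'a::euclidean_space set"
  assumes "cball 0 r \<subseteq> K" "0 < r" shows "polar K \<subseteq> cball 0 (1/r)"
proof
  fix y assume y: "y \<in> polar K"
  show "y \<in> cball 0 (1/r)"
  proof (cases "y = 0")
    case False
    have "(r / norm y) *\<^sub>R y \<in> K" using assms False by (intro subsetD[OF assms(1)]) auto
    then have "(r / norm y) *\<^sub>R y \<bullet> y \<le> 1" using y by (auto simp: polar_def)
    then have "r * norm y \<le> 1" using False by (simp add: power2_norm_eq_inner[symmetric] power2_eq_square)
    then show ?thesis using assms by (simp add: field_simps)
  qed (use assms in auto)
qed

text \<open>
A finite \<open>d r\<close>-net of \<open>P\<close> loses at most \<open>d r |x|\<close> of the support function, and \<open>r |x|\<close> is itself bounded by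
the support function because \<open>P\<close> contains the ball of radius \<open>r\<close>; so the loss is relative. Adding the
reflected points makes the net symmetric, which makes the gradient of the soft maximum over the net vanish at \<open>0\<close>.
\<close>

lemma finite_symmetric_net:
  fixes P :: "'a::euclidean_space set"
  assumes P: "compact P" "uminus ` P = P" and ball: "cball 0 r \<subseteq> P" "0 < r" and d: "0 < d"
  obtains S where "finite S" "S \<noteq> {}" "S \<subseteq> P" "uminus ` S = S"
    "\<And>x. \<exists>y\<in>S. (1 - d) * support P x \<le> x \<bullet> y"
proof -
  have ne: "P \<noteq> {}" using ball by auto
  obtain S0 where S0: "finite S0" "S0 \<subseteq> P" "P \<subseteq> (\<Union>y\<in>S0. ball y (d * r))"
    using seq_compact_imp_totally_bounded[of P] compact_imp_seq_compact[OF P(1)] ball(2) d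
    by (meson mult_pos_pos)
  define S where "S = S0 \<union> uminus ` S0"
  have "S0 \<noteq> {}" using S0 ne by auto
  have "uminus ` uminus ` S0 = S0" by (simp add: image_image)
  then have sym: "uminus ` S = S" by (auto simp: S_def image_Un)
  have "\<exists>y\<in>S. (1 - d) * support P x \<le> x \<bullet> y" for x
  proof -
    obtain z where z: "z \<in> P" "support P x = x \<bullet> z" using support_attained[OF P(1) ne, of x] by blast
    obtain y where y: "y \<in> S0" "dist y z < d * r" using S0(3) z(1) by auto
    have "r * norm x \<le> support P x"
    proof (cases "x = 0")
      case False
      have "(r / norm x) *\<^sub>R x \<in> P" using ball False by (intro subsetD[OF ball(1)]) auto
      then have "x \<bullet> ((r / norm x) *\<^sub>R x) \<le> support P x" by (rule support_ge[OF P(1) ne])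
      then show ?thesis using False by (simp add: power2_norm_eq_inner[symmetric] power2_eq_square)
    qed (use support_ge[OF P(1) ne z(1), of 0] in simp)
    then have "d * (r * norm x) \<le> d * support P x" using d by (intro mult_left_mono) auto
    moreover have "x \<bullet> z - x \<bullet> y \<le> norm x * (d * r)"
      using norm_cauchy_schwarz[of x "z - y"] y(2) mult_left_mono[of "norm (z - y)" "d * r" "norm x"]
      by (simp add: inner_diff_right dist_norm norm_minus_commute)
    ultimately show ?thesis
      using y(1) z(2) by (intro bexI[of _ y]) (auto simp: S_def algebra_simps)
  qed
  moreover have "S \<subseteq> P" using S0(2) P(2) by (auto simp: S_def)
  ultimately show ?thesis using that[of S] S0(1) \<open>S0 \<noteq> {}\<close> sym by (auto simp: S_def)
qed

section \<open>Volumes of sublevel sets as exponential integrals\<close>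

lemma emeasure_lborel_compact:
  fixes A :: "'a::euclidean_space set"
  assumes "compact A" shows "emeasure lborel A = ennreal (measure lebesgue A)"
proof -
  have "A \<in> sets lborel" using assms by (simp add: borel_compact)
  moreover have "emeasure lborel A \<noteq> top" using emeasure_compact_finite[OF assms] by simp
  ultimately show ?thesis by (simp add: emeasure_eq_ennreal_measure measure_completion)
qed

lemma emeasure_sublevel_homogeneous:
  fixes g :: "'a::euclidean_space \<Rightarrow> real"
  assumes [measurable]: "g \<in> borel_measurable borel"
    and hom: "\<And>t x. 0 < t \<Longrightarrow> g (t *\<^sub>R x) = t * g x" and t: "0 < t"
  shows "emeasure lborel {x. g x \<le> t} = ennreal (t ^ DIM('a)) * emeasure lborel {x. g x \<le> 1}"
proof -
  have img: "{x. g x \<le> t} = (\<lambda>x. t *\<^sub>R x + 0) ` {x. g x \<le> 1}"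
  proof (intro equalityI subsetI)
    fix x assume "x \<in> {x. g x \<le> t}"
    then have "t * g ((1/t) *\<^sub>R x) \<le> t * 1" using t hom[of t "(1/t) *\<^sub>R x"] by simp
    then have "g ((1/t) *\<^sub>R x) \<le> 1" using t by (simp only: mult_le_cancel_left_pos)
    then show "x \<in> (\<lambda>x. t *\<^sub>R x + 0) ` {x. g x \<le> 1}"
      using t by (intro image_eqI[of _ _ "(1/t) *\<^sub>R x"]) auto
  qed (use t hom in \<open>auto simp: mult_left_le\<close>)
  have "emeasure lborel {x. g x \<le> t} = emeasure lebesgue {x. g x \<le> t}"
    by simp
  also have "\<dots> = ennreal (t ^ DIM('a)) * emeasure lebesgue {x. g x \<le> 1}"
    unfolding img using emeasure_lebesgue_affine[of t 0 "{x. g x \<le> 1}"] t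
    by (simp only: ennreal_power abs_of_pos less_imp_le)
  finally show ?thesis by simp
qed

text \<open>
Layer cake: writing \<open>exp (- g x)\<close> as the integral of \<open>exp (- t)\<close> over \<open>t \<ge> g x\<close> and exchanging the
integrations leaves \<open>|{g \<le> 1}|\<close> times the Gamma integral of \<open>t\<^sup>n exp (- t)\<close>. This is where the factor \<open>n!\<close>
of the Mahler volume comes from.
\<close>

lemma nn_integral_exp_minus_homogeneous:
  fixes g :: "'a::euclidean_space \<Rightarrow> real"
  assumes [measurable]: "g \<in> borel_measurable borel"
    and nonneg: "\<And>x. 0 \<le> g x" and hom: "\<And>t x. 0 < t \<Longrightarrow> g (t *\<^sub>R x) = t * g x"
  shows "(\<integral>\<^sup>+x. ennreal (exp (- g x)) \<partial>lborel) = ennreal (fact DIM('a)) * emeasure lborel {x. g x \<le> 1}"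
proof -
  let ?n = "DIM('a)"
  have tail: "ennreal (exp (- a)) = (\<integral>\<^sup>+t. ennreal (exp (- t)) * indicator {a..} t \<partial>lborel)" for a :: real
  proof -
    have "(\<integral>\<^sup>+t. ennreal (exp (- t)) * indicator {a..} t \<partial>lborel) = 0 - (- exp (- a))"
    proof (rule nn_integral_FTC_atLeast)
      show "((\<lambda>t. - exp (- t)) has_real_derivative exp (- t)) (at t)" for t :: real
        by (auto intro!: derivative_eq_intros)
      show "((\<lambda>t::real. - exp (- t)) \<longlongrightarrow> 0) at_top" by real_asymp
    qed auto
    then show ?thesis by simp
  qed
  have level: "emeasure lborel {x. g x \<le> t} = ennreal (t ^ ?n) * emeasure lborel {x. g x \<le> 1}" if "0 < t" for t
    using emeasure_sublevel_homogeneous[OF assms(1) hom that] .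
  have "(\<integral>\<^sup>+x. ennreal (exp (- g x)) \<partial>lborel)
      = (\<integral>\<^sup>+x. \<integral>\<^sup>+t. ennreal (exp (- t)) * indicator {g x..} t \<partial>lborel \<partial>lborel)"
    by (intro nn_integral_cong tail)
  also have "\<dots> = (\<integral>\<^sup>+t. \<integral>\<^sup>+x. ennreal (exp (- t)) * indicator {g x..} t \<partial>lborel \<partial>lborel)"
  proof (rule lborel_pair.Fubini')
    have "(\<lambda>(t::real, x::'a). ennreal (exp (- t)) * (if g x \<le> t then 1 else 0)) \<in> borel_measurable (lborel \<Otimes>\<^sub>M lborel)"
      by measurable
    then show "(\<lambda>(t::real, x::'a). ennreal (exp (- t)) * indicator {g x..} t) \<in> borel_measurable (lborel \<Otimes>\<^sub>M lborel)"
      by (simp add: indicator_def)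
  qed
  also have "\<dots> = (\<integral>\<^sup>+t. ennreal (exp (- t)) * emeasure lborel {x. g x \<le> t} \<partial>lborel)"
  proof (rule nn_integral_cong)
    fix t :: real
    have "(\<integral>\<^sup>+x. ennreal (exp (- t)) * indicator {g x..} t \<partial>lborel)
        = (\<integral>\<^sup>+x. ennreal (exp (- t)) * indicator {x. g x \<le> t} x \<partial>lborel)"
      by (intro nn_integral_cong) (auto simp: indicator_def)
    also have "\<dots> = ennreal (exp (- t)) * emeasure lborel {x. g x \<le> t}"
      by (subst nn_integral_cmult_indicator) auto
    finally show "(\<integral>\<^sup>+x. ennreal (exp (- t)) * indicator {g x..} t \<partial>lborel)
        = ennreal (exp (- t)) * emeasure lborel {x. g x \<le> t}" .
  qed
  also have "\<dots> = (\<integral>\<^sup>+t. (ennreal (t ^ ?n * exp (- t)) * indicator {0..} t) * emeasure lborel {x. g x \<le> 1} \<partial>lborel)"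
  proof (rule nn_integral_cong_AE)
    have "AE t in lborel. t \<noteq> (0::real)" by (rule AE_lborel_singleton)
    then show "AE t in lborel. ennreal (exp (- t)) * emeasure lborel {x. g x \<le> t}
        = (ennreal (t ^ ?n * exp (- t)) * indicator {0..} t) * emeasure lborel {x. g x \<le> 1}"
    proof (eventually_elim)
      case (elim t)
      show ?case
      proof (cases "0 < t")
        case True
        then show ?thesis unfolding level[OF True] by (simp add: ennreal_mult mult_ac)
      next
        case False
        then have "{x. g x \<le> t} = {}" using elim nonneg by (auto simp: not_le) (meson less_le_trans not_le order_less_le)
        then show ?thesis using False elim by simp
      qed
    qed
  qed
  also have "\<dots> = (\<integral>\<^sup>+t. ennreal (t ^ ?n * exp (- t)) * indicator {0..} t \<partial>lborel) * emeasure lborel {x. g x \<le> 1}"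
    by (subst nn_integral_multc) auto
  also have "\<dots> = ennreal (fact ?n) * emeasure lborel {x. g x \<le> 1}"
    unfolding nn_intergal_power_times_exp_Ici by simp
  finally show ?thesis .
qed

lemma nn_integral_exp_minus_scaled:
  fixes g :: "'a::euclidean_space \<Rightarrow> real"
  assumes [measurable]: "g \<in> borel_measurable borel"
    and nonneg: "\<And>x. 0 \<le> g x" and hom: "\<And>t x. 0 < t \<Longrightarrow> g (t *\<^sub>R x) = t * g x" and s: "0 < s"
  shows "(\<integral>\<^sup>+x. ennreal (exp (- (s * g x))) \<partial>lborel)
    = ennreal (fact DIM('a) * (1/s) ^ DIM('a)) * emeasure lborel {x. g x \<le> 1}"
proof -
  have "(\<integral>\<^sup>+x. ennreal (exp (- (s * g x))) \<partial>lborel)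
      = ennreal (fact DIM('a)) * emeasure lborel {x. s * g x \<le> 1}"
    using s nonneg hom by (intro nn_integral_exp_minus_homogeneous) auto
  also have "{x. s * g x \<le> 1} = {x. g x \<le> 1/s}"
    using s by (auto simp: field_simps)
  also have "emeasure lborel {x. g x \<le> 1/s} = ennreal ((1/s) ^ DIM('a)) * emeasure lborel {x. g x \<le> 1}"
    using s by (intro emeasure_sublevel_homogeneous hom) auto
  finally show ?thesis using s by (simp add: ennreal_mult mult.assoc)
qed

text \<open>
The integrands decrease to the indicator of \<open>{q \<le> 2}\<close>.
\<close>

lemma tendsto_integral_truncation:
  fixes q :: "'a::euclidean_space \<Rightarrow> real"
  assumes [measurable]: "q \<in> borel_measurable borel"
    and nonneg: "\<And>x. 0 \<le> q x" and hom: "\<And>t x. 0 < t \<Longrightarrow> q (t *\<^sub>R x) = t * q x"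
    and fin: "emeasure lborel {x. q x \<le> 1} < \<infinity>"
  shows "(\<lambda>k. \<integral>\<^sup>+b. ennreal (exp (- (real (Suc k) * max 0 (q b / 2 - 1)))) \<partial>lborel)
    \<longlonglongrightarrow> ennreal (2 ^ DIM('a)) * emeasure lborel {x. q x \<le> 1}"
proof -
  have "(\<lambda>k. \<integral>\<^sup>+b. ennreal (exp (- (real (Suc k) * max 0 (q b / 2 - 1)))) \<partial>lborel)
      \<longlonglongrightarrow> (\<integral>\<^sup>+b. indicator {b. q b \<le> 2} b \<partial>lborel)"
  proof (rule nn_integral_dominated_convergence[where w = "\<lambda>b. ennreal (exp 1) * ennreal (exp (- (1/2 * q b)))"])
    show "AE b in lborel. ennreal (exp (- (real (Suc k) * max 0 (q b / 2 - 1))))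
        \<le> ennreal (exp 1) * ennreal (exp (- (1/2 * q b)))" for k
    proof (rule AE_I2)
      fix b
      have "q b / 2 - 1 \<le> max 0 (q b / 2 - 1)" by simp
      also have "\<dots> \<le> real (Suc k) * max 0 (q b / 2 - 1)"
        using mult_right_mono[of 1 "real (Suc k)" "max 0 (q b / 2 - 1)"] by simp
      finally have "exp (- (real (Suc k) * max 0 (q b / 2 - 1))) \<le> exp (1 + - (1/2 * q b))"
        by simp
      then show "ennreal (exp (- (real (Suc k) * max 0 (q b / 2 - 1))))
        \<le> ennreal (exp 1) * ennreal (exp (- (1/2 * q b)))"
        unfolding exp_add by (simp only: ennreal_mult[symmetric] exp_ge_zero ennreal_leI)
    qed
    have "(\<integral>\<^sup>+b. ennreal (exp (- (1/2 * q b))) \<partial>lborel) < \<infinity>"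
      using nn_integral_exp_minus_scaled[OF assms(1) nonneg hom, of "1/2"] fin
      by (simp add: ennreal_mult_less_top)
    then show "(\<integral>\<^sup>+b. ennreal (exp 1) * ennreal (exp (- (1/2 * q b))) \<partial>lborel) < \<infinity>"
      by (subst nn_integral_cmult) (auto simp: ennreal_mult_less_top)
    show "AE b in lborel. (\<lambda>k. ennreal (exp (- (real (Suc k) * max 0 (q b / 2 - 1)))))
        \<longlonglongrightarrow> indicator {b. q b \<le> 2} b"
    proof (rule AE_I2)
      fix b
      show "(\<lambda>k. ennreal (exp (- (real (Suc k) * max 0 (q b / 2 - 1))))) \<longlonglongrightarrow> indicator {b. q b \<le> 2} b"
      proof (cases "q b \<le> 2")
        case True
        then show ?thesis by (simp add: max_def)
      next
        case False
        define m where "m = q b / 2 - 1"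
        have m: "0 < m" using False by (simp add: m_def)
        have "(\<lambda>k. exp (- (real (Suc k) * m))) \<longlonglongrightarrow> 0" using m by real_asymp
        then have "(\<lambda>k. ennreal (exp (- (real (Suc k) * m)))) \<longlonglongrightarrow> ennreal 0"
          by (rule tendsto_ennrealI)
        then show ?thesis using False m by (simp add: m_def[symmetric] max_def)
      qed
    qed
  qed auto
  also have "(\<integral>\<^sup>+b. indicator {b. q b \<le> 2} b \<partial>lborel) = emeasure lborel {b. q b \<le> 2}"
    by (rule nn_integral_indicator) simp
  also have "\<dots> = ennreal (2 ^ DIM('a)) * emeasure lborel {x. q x \<le> 1}"
    by (intro emeasure_sublevel_homogeneous hom) auto
  finally show ?thesis .
qed

section \<open>Symmetric convex bodies\<close>

text \<open>
Here \<open>T\<close> is the gradient of a soft maximum over a net of \<open>P\<close> plus a small multiple of \<open>|x|\<^sup>2\<close>. Applying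
Young's inequality to \<open>u\<close> with test vector \<open>x\<close> and to \<open>v\<close> with test vector \<open>- x\<close> bounds
\<open>u \<bullet> T u + v \<bullet> T v\<close> below by the value of the convex function at \<open>u\<close> and \<open>v\<close> plus \<open>x \<bullet> (T u - T v)\<close> minus the
cost of \<open>x\<close>. Subadditivity turns the first part into a function of \<open>u + v\<close>. The test vector is \<open>0\<close> when
\<open>(T u - T v) / 2\<close> lies in the polar of \<open>K\<close>, and otherwise \<open>k\<close> times a point of \<open>K\<close> at which the support
function is attained, which yields a penalty of slope \<open>k\<close>.
\<close>

lemma symmetric_body_integral_bound:
  fixes K P :: "(real^'n) set"
  assumes K: "compact K" "uminus ` K = K" "cball 0 \<rho> \<subseteq> K" "0 < \<rho>"
    and P: "compact P" "uminus ` P = P" "cball 0 r \<subseteq> P" "0 < r"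
    and KP: "\<And>x. x \<in> K \<Longrightarrow> support P x \<le> 1"
    and k: "1 \<le> k"
  shows "ennreal ((4 * pi) ^ CARD('n)) \<le> ennreal (exp (2 / k)) *
      ((\<integral>\<^sup>+a. ennreal (exp (- ((1 - 1/k) / 2 * support P a))) \<partial>lborel) *
       (\<integral>\<^sup>+b. ennreal (exp (- (k * max 0 (support K b / 2 - 1)))) \<partial>lborel))"
proof -
  have ne: "K \<noteq> {}" "P \<noteq> {}" "0 \<in> P" using K(3,4) P(3,4) by auto
  note [measurable] = support_measurable[OF K(1) ne(1)] support_measurable[OF P(1) ne(2)]
  have k0: "0 < k" "0 < 1/k" using k by auto
  obtain R where R: "\<And>x. x \<in> K \<Longrightarrow> norm x \<le> R" "0 < R"
    using compact_imp_bounded[OF K(1)] unfolding bounded_pos by auto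
  obtain Q where Q: "\<And>x. x \<in> P \<Longrightarrow> norm x \<le> Q" "0 < Q"
    using compact_imp_bounded[OF P(1)] unfolding bounded_pos by auto
  obtain S where Sf: "finite S" "S \<noteq> {}" "S \<subseteq> P" "uminus ` S = S"
    and net: "\<And>x. \<exists>y\<in>S. (1 - 1/k) * support P x \<le> x \<bullet> y"
    using finite_symmetric_net[OF P(1,2,3,4) k0(2)] by metis
  \<comment> \<open>With these choices the soft maximum and the quadratic term each cost at most \<open>1/k\<close>.\<close>
  define p where "p = k * ln (real (card S)) + 1"
  define e where "e = 4 / (k^3 * R\<^sup>2)"
  have card: "1 \<le> real (card S)" using Sf(1,2) by (simp add: Suc_le_eq card_gt_0_iff)
  have p_bounds: "0 < p" "ln (real (card S)) / p \<le> 1 / k"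
    using k0 card ln_ge_zero[OF card] by (auto simp: p_def field_simps add_pos_nonneg intro: add_nonneg_pos)
  have e: "0 < e" using k0 R(2) by (simp add: e_def)
  interpret soft_maximum S p by unfold_locales (use Sf p_bounds in auto)
  define T where "T x = mean x + e *\<^sub>R x" for x
  define \<Psi> where "\<Psi> = (\<lambda>(a, b). ennreal (exp (2 / k)) * (ennreal (exp (- ((1 - 1/k) / 2 * support P a)))
     * ennreal (exp (- (k * max 0 (support K b / 2 - 1))))))"
  have S_norm: "norm y \<le> Q" if "y \<in> S" for y using Q(1) Sf(3) that by blast
  have softmax_upper: "softmax x \<le> support P x + 1 / k" for x
    using softmax_le[of x "support P x"] support_ge[OF P(1) ne(2)] Sf(3) p_bounds(2) by force
  have softmax_lower: "(1 - 1/k) * support P x \<le> softmax x" for x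
    using net[of x] softmax_ge order_trans by blast
  have dual: "(1 - 1/k) * support P u + x \<bullet> T u - softmax x - e / 4 * (norm x)\<^sup>2 \<le> u \<bullet> T u" for u x
  proof -
    have "e * (x \<bullet> u) - e / 4 * (norm x)\<^sup>2 \<le> e * (u \<bullet> u)"
    proof -
      have "0 \<le> e * ((u - (1/2) *\<^sub>R x) \<bullet> (u - (1/2) *\<^sub>R x))" using e by simp
      then show ?thesis by (simp add: power2_norm_eq_inner inner_diff inner_commute algebra_simps)
    qed
    moreover have "softmax u + x \<bullet> mean u - u \<bullet> mean u \<le> softmax x"
      using softmax_tangent[of u x] by (simp add: inner_diff_left)
    ultimately show ?thesis
      using softmax_lower[of u] by (simp add: T_def inner_add_right)
  qed
  have main: "(1 - 1/k) / 2 * support P (u + v) + x \<bullet> (T u - T v) / 2 - support P x - 1 / k - e / 4 * (norm x)\<^sup>2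
      \<le> (u \<bullet> T u + v \<bullet> T v) / 2" for u v x
  proof -
    have "(1 - 1/k) * support P (u + v) \<le> (1 - 1/k) * (support P u + support P v)"
      using k support_add[OF P(1) ne(2)] by (intro mult_left_mono) auto
    then show ?thesis
      using dual[of u x] dual[of v "- x"] softmax_upper[of x] softmax_upper[of "- x"]
        support_uminus[OF P(1) ne(2) P(2), of x]
      by (simp add: inner_diff_right distrib_left) argo
  qed
  have pointwise: "(1 - 1/k) / 2 * support P (u + v) + k * max 0 (support K (T u - T v) / 2 - 1) - 2 / k
      \<le> (u \<bullet> T u + v \<bullet> T v) / 2" for u v
  proof (cases "support K (T u - T v) / 2 - 1 \<le> 0")
    case True
    have "support P 0 \<le> 0" by (simp add: support_le_iff[OF P(1) ne(2)])
    moreover have "(1 - 1/k) / 2 * support P (u + v) - support P 0 - 1 / k \<le> (u \<bullet> T u + v \<bullet> T v) / 2"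
      using main[of u v 0] by (simp only: inner_zero_left norm_zero) simp
    moreover have "k * max 0 (support K (T u - T v) / 2 - 1) = 0" using True by (simp add: max_def)
    moreover have "2 / k = 1 / k + 1 / k" by simp
    ultimately show ?thesis using k0(2) by linarith
  next
    case False
    obtain x where x: "x \<in> K" "support K (T u - T v) = (T u - T v) \<bullet> x"
      using support_attained[OF K(1) ne(1)] by blast
    have "support P (k *\<^sub>R x) \<le> k"
      using KP[OF x(1)] k0 support_scale[OF P(1) ne(2), of k x] mult_left_mono[of "support P x" 1 k] by simp
    moreover have "e / 4 * (norm (k *\<^sub>R x))\<^sup>2 \<le> 1 / k"
    proof -
      have "e / 4 * (norm (k *\<^sub>R x))\<^sup>2 \<le> e / 4 * (k * R)\<^sup>2"
        using e k0 R(1)[OF x(1)] by (intro mult_left_mono power_mono) auto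
      also have "\<dots> = 1 / k"
        using k0 R(2) by (simp add: e_def field_simps power2_eq_square power3_eq_cube)
      finally show ?thesis .
    qed
    moreover have "(k *\<^sub>R x) \<bullet> (T u - T v) / 2 = k * (support K (T u - T v) / 2)"
      using x(2) by (simp add: inner_commute)
    moreover have "k * max 0 (support K (T u - T v) / 2 - 1) = k * (support K (T u - T v) / 2) - k"
      using False by (simp add: max_def right_diff_distrib)
    moreover have "2 / k = 1 / k + 1 / k" by simp
    ultimately show ?thesis using main[of u v "k *\<^sub>R x"] by linarith
  qed
  have "ennreal ((4 * pi) ^ CARD('n)) \<le> (\<integral>\<^sup>+q. \<Psi> q \<partial>lborel)"
  proof (rule monotone_graph_volume_bound[where T = T])
    show "0 < e" by (rule e)
    show "T 0 = 0" by (simp add: T_def mean_0[OF Sf(4)])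
    show "e * (norm (x - y))\<^sup>2 \<le> (T x - T y) \<bullet> (x - y)" for x y
      using mean_mono[of x y]
      by (simp add: T_def power2_norm_eq_inner inner_diff inner_add algebra_simps)
    show "norm (T x - T y) \<le> (2 * p * Q\<^sup>2 + e) * norm (x - y)" for x y
    proof -
      have "T x - T y = (mean x - mean y) + e *\<^sub>R (x - y)" by (simp add: T_def algebra_simps)
      then have "norm (T x - T y) \<le> norm (mean x - mean y) + e * norm (x - y)"
        using norm_triangle_ineq[of "mean x - mean y" "e *\<^sub>R (x - y)"] e by simp
      then show ?thesis
        using mean_lipschitz[OF S_norm, of x y] by (simp add: algebra_simps)
    qed
    show "(T has_derivative (\<lambda>h. mean' x h + e *\<^sub>R h)) (at x)" for x
      unfolding T_def[abs_def] by (auto intro!: derivative_eq_intros mean_deriv)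
    show "continuous_on UNIV (\<lambda>x. mean' x h + e *\<^sub>R h)" for h
      by (intro continuous_intros mean'_cont)
    show "\<Psi> \<in> borel_measurable borel"
      unfolding \<Psi>_def borel_prod[symmetric] by measurable
    show "ennreal (exp (- ((u \<bullet> T u + v \<bullet> T v) / 2))) \<le> \<Psi> (u + v, T u - T v)" for u v
    proof -
      have "- ((u \<bullet> T u + v \<bullet> T v) / 2) \<le> 2 / k + (- ((1 - 1/k) / 2 * support P (u + v))
          + - (k * max 0 (support K (T u - T v) / 2 - 1)))"
        using pointwise[of u v] by linarith
      then have "exp (- ((u \<bullet> T u + v \<bullet> T v) / 2)) \<le> exp (2 / k) * (exp (- ((1 - 1/k) / 2 * support P (u + v)))
          * exp (- (k * max 0 (support K (T u - T v) / 2 - 1))))"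
        by (simp only: exp_add[symmetric] exp_le_cancel_iff)
      then show ?thesis
        unfolding \<Psi>_def case_prod_conv by (simp only: ennreal_mult[symmetric] exp_ge_zero mult_nonneg_nonneg ennreal_leI)
    qed
  qed
  also have "\<dots> = (\<integral>\<^sup>+a. \<integral>\<^sup>+b. \<Psi> (a, b) \<partial>lborel \<partial>lborel)"
    unfolding lborel_prod[symmetric]
    by (rule lborel.nn_integral_fst[symmetric]) (simp add: \<Psi>_def)
  also have "\<dots> = ennreal (exp (2 / k)) *
      ((\<integral>\<^sup>+a. ennreal (exp (- ((1 - 1/k) / 2 * support P a))) \<partial>lborel) *
       (\<integral>\<^sup>+b. ennreal (exp (- (k * max 0 (support K b / 2 - 1)))) \<partial>lborel))"
    by (simp add: \<Psi>_def nn_integral_cmult nn_integral_multc)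
  finally show ?thesis .
qed

text \<open>
As \<open>k\<close> grows, the two integrals in \<open>symmetric_body_integral_bound\<close> tend to \<open>n! |2 K|\<close> and \<open>|2 K\<^sup>o|\<close>.
\<close>

theorem symmetric_mahler_bound:
  fixes K :: "(real^'n) set"
  assumes K: "convex_body K" "uminus ` K = K" "0 \<in> interior K"
  shows "pi ^ CARD('n) \<le> mahler_volume K"
proof -
  let ?n = "CARD('n)"
  define P where "P = polar K"
  have comp: "compact K" and conv: "convex K" using K(1) by (auto simp: convex_body_def)
  obtain \<rho> where \<rho>: "0 < \<rho>" "cball 0 \<rho> \<subseteq> K" using K(3) by (auto simp: mem_interior_cball)
  obtain R where R: "0 < R" "K \<subseteq> cball 0 R"
    using compact_imp_bounded[OF comp] unfolding bounded_pos by (auto simp: subset_iff)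
  have P_ball: "cball 0 (1/R) \<subseteq> P" "0 < 1/R"
    unfolding P_def using cball_subset_polar[OF R(2,1)] R(1) by auto
  have "bounded P" unfolding P_def
    using polar_subset_cball[OF \<rho>(2,1)] bounded_subset bounded_cball by blast
  then have P_comp: "compact P" unfolding P_def using polar_closed compact_eq_bounded_closed by blast
  have P_sym: "uminus ` P = P"
  proof -
    have "- y \<in> P" if "y \<in> P" for y
      unfolding P_def polar_def
    proof safe
      fix x assume "x \<in> K"
      then have "- x \<in> K" using K(2) by blast
      then show "x \<bullet> - y \<le> 1" using that by (auto simp: P_def polar_def)
    qed
    then show ?thesis by (auto intro: image_eqI[of _ _ "- _"])
  qed
  have ne: "K \<noteq> {}" "P \<noteq> {}" "0 \<in> K" "0 \<in> P" using \<rho> P_ball by auto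
  have K_eq: "{x. support P x \<le> 1} = K"
  proof (intro equalityI subsetI)
    fix x assume "x \<in> {x. support P x \<le> 1}"
    then have "\<forall>y\<in>P. x \<bullet> y \<le> 1" by (simp add: support_le_iff[OF P_comp ne(2)])
    then show "x \<in> K"
      unfolding P_def by (intro bipolar_subset[OF compact_imp_closed[OF comp] conv ne(3)]) auto
  next
    fix x assume "x \<in> K"
    then have "\<forall>y\<in>P. x \<bullet> y \<le> 1" by (auto simp: P_def polar_def)
    then show "x \<in> {x. support P x \<le> 1}" by (simp add: support_le_iff[OF P_comp ne(2)])
  qed
  have P_eq: "{y. support K y \<le> 1} = P"
    unfolding P_def by (rule polar_eq_support[OF comp ne(1), symmetric])
  note emK = emeasure_lborel_compact[OF comp] and emP = emeasure_lborel_compact[OF P_comp]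
  note suppK = support_measurable[OF comp ne(1)] support_nonneg[OF comp ne(1) ne(3)] support_scale[OF comp ne(1) less_imp_le]
  note suppP = support_measurable[OF P_comp ne(2)] support_nonneg[OF P_comp ne(2) ne(4)] support_scale[OF P_comp ne(2) less_imp_le]
  define c where "c k = exp (2 / real (Suc k)) * (fact ?n * (1 / ((1 - 1 / real (Suc k)) / 2)) ^ ?n * measure lebesgue K)" for k
  define B where "B k = (\<integral>\<^sup>+b. ennreal (exp (- (real (Suc k) * max 0 (support K b / 2 - 1)))) \<partial>lborel)" for k
  have bound: "ennreal ((4 * pi) ^ ?n) \<le> ennreal (c k) * B k" if "1 \<le> k" for k
  proof -
    have "(\<integral>\<^sup>+a. ennreal (exp (- ((1 - 1 / real (Suc k)) / 2 * support P a))) \<partial>lborel)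
        = ennreal (fact ?n * (1 / ((1 - 1 / real (Suc k)) / 2)) ^ ?n) * emeasure lborel K"
      using nn_integral_exp_minus_scaled[OF suppP, of "(1 - 1 / real (Suc k)) / 2"] that
      by (simp add: K_eq)
    moreover have "ennreal ((4 * pi) ^ ?n) \<le> ennreal (exp (2 / real (Suc k))) *
      ((\<integral>\<^sup>+a. ennreal (exp (- ((1 - 1 / real (Suc k)) / 2 * support P a))) \<partial>lborel) * B k)"
      unfolding B_def
      by (rule symmetric_body_integral_bound[OF comp K(2) \<rho>(2,1) P_comp P_sym P_ball]) (use K_eq in auto)
    ultimately show ?thesis
      unfolding c_def emK by (simp add: ennreal_mult mult.assoc)
  qed
  have lim_c: "c \<longlonglongrightarrow> exp 0 * (fact ?n * (1 / ((1 - 0) / 2)) ^ ?n * measure lebesgue K)"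
  proof -
    have "(\<lambda>k. 2 / real (Suc k)) \<longlonglongrightarrow> 0" "(\<lambda>k. 1 / real (Suc k)) \<longlonglongrightarrow> 0" by real_asymp+
    then show ?thesis unfolding c_def by (intro tendsto_intros) auto
  qed
  have lim_B: "B \<longlonglongrightarrow> ennreal (2 ^ ?n) * emeasure lborel P"
    unfolding B_def[abs_def]
    using tendsto_integral_truncation[OF suppK] by (simp only: P_eq emP ennreal_less_top) simp
  have "(\<lambda>k. ennreal (c k) * B k) \<longlonglongrightarrow> ennreal (exp 0 * (fact ?n * (1 / ((1 - 0) / 2)) ^ ?n * measure lebesgue K))
      * (ennreal (2 ^ ?n) * emeasure lborel P)"
    by (intro tendsto_mult_ennreal lim_B tendsto_ennrealI lim_c) (simp add: emP ennreal_mult[symmetric])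
  then have "ennreal ((4 * pi) ^ ?n) \<le> ennreal (exp 0 * (fact ?n * (1 / ((1 - 0) / 2)) ^ ?n * measure lebesgue K))
      * (ennreal (2 ^ ?n) * emeasure lborel P)"
    by (rule LIMSEQ_le_const) (use bound in blast)
  also have "\<dots> = ennreal (fact ?n * 2 ^ ?n * measure lebesgue K * (2 ^ ?n * measure lebesgue P))"
    by (simp add: emP ennreal_mult[symmetric])
  finally have "(4 * pi) ^ ?n \<le> fact ?n * 2 ^ ?n * measure lebesgue K * (2 ^ ?n * measure lebesgue P)"
    by (simp add: ennreal_le_iff)
  also have "\<dots> = 4 ^ ?n * mahler_volume K"
  proof -
    have "(4::real) ^ ?n = 2 ^ ?n * 2 ^ ?n" by (simp only: power_mult_distrib[symmetric]) simp
    then show ?thesis by (simp add: mahler_volume_def P_def)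
  qed
  finally show ?thesis by (simp add: power_mult_distrib)
qed

section \<open>Difference bodies and the general case\<close>

definition difference_body :: "'a::euclidean_space set \<Rightarrow> 'a set" where
  "difference_body K = {x - y | x y. x \<in> K \<and> y \<in> K}"

text \<open>
The volume of \<open>K \<inter> (K + z)\<close>, integrated over all \<open>z\<close>, is \<open>|K|\<^sup>2\<close>. If \<open>z = (a - b) / 2\<close> with \<open>a\<close> and \<open>b\<close> in \<open>K\<close>,
the intersection contains a translate of \<open>K / 2\<close>, and such \<open>z\<close> fill half of the difference body. This
gives \<open>2\<^sup>-\<^sup>n |K| \<cdot> 2\<^sup>-\<^sup>n |K - K| \<le> |K|\<^sup>2\<close>, a crude form of the Rogers--Shephard inequality.
\<close>

lemma measure_difference_body_le:
  fixes K :: "'a::euclidean_space set"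
  assumes K: "compact K" "convex K" "interior K \<noteq> {}"
  shows "measure lebesgue (difference_body K) \<le> 4 ^ DIM('a) * measure lebesgue K"
proof -
  define A where "A = difference_body K"
  define B where "B = (\<lambda>z. (1/2) *\<^sub>R z + 0) ` A"
  have A: "compact A" unfolding A_def difference_body_def by (rule compact_differences[OF K(1,1)])
  then have B: "compact B" unfolding B_def by (intro compact_continuous_image continuous_intros)
  have [measurable]: "K \<in> sets borel" "B \<in> sets borel" using K(1) B by (auto simp: borel_compact)
  have vol: "emeasure lborel ((\<lambda>x. m *\<^sub>R x + c) ` S) = ennreal (\<bar>m\<bar> ^ DIM('a) * measure lebesgue S)"
    if "compact S" for m c and S :: "'a set"
  proof -
    have "compact ((\<lambda>x. m *\<^sub>R x + c) ` S)"
      using that by (intro compact_continuous_image continuous_intros)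
    from emeasure_lborel_compact[OF this] show ?thesis by (simp only: measure_lebesgue_affine)
  qed
  have lower: "ennreal ((1/2) ^ DIM('a) * measure lebesgue K) * indicator B z
      \<le> (\<integral>\<^sup>+x. indicator K x * indicator K (x - z) \<partial>lborel)" for z
  proof (cases "z \<in> B")
    case True
    then obtain a b where ab: "a \<in> K" "b \<in> K" "z = (1/2) *\<^sub>R (a - b)"
      by (auto simp: B_def A_def difference_body_def)
    let ?S = "(\<lambda>x. (1/2) *\<^sub>R x + (1/2) *\<^sub>R a) ` K"
    have S: "compact ?S" using K(1) by (intro compact_continuous_image continuous_intros)
    have sub: "x \<in> K \<and> x - z \<in> K" if x: "x \<in> ?S" for x
    proof -
      obtain y where y: "y \<in> K" "x = (1/2) *\<^sub>R y + (1/2) *\<^sub>R a" using x by blast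
      have diff: "x - z = (1/2) *\<^sub>R y + (1/2) *\<^sub>R b"
        by (simp add: y ab algebra_simps)
      have mid: "(1/2) *\<^sub>R y + (1/2) *\<^sub>R c \<in> K" if "c \<in> K" for c
        using K(2) y(1) that unfolding convex_def by auto
      show ?thesis
        unfolding diff using mid[OF ab(1)] mid[OF ab(2)] y(2) by simp
    qed
    have "ennreal ((1/2) ^ DIM('a) * measure lebesgue K) = emeasure lborel ?S"
      using vol[OF K(1), of "1/2" "(1/2) *\<^sub>R a"] by simp
    also have "\<dots> = (\<integral>\<^sup>+x. indicator ?S x \<partial>lborel)"
      using S by (simp add: borel_compact)
    also have "\<dots> \<le> (\<integral>\<^sup>+x. indicator K x * indicator K (x - z) \<partial>lborel)"
      using sub by (intro nn_integral_mono) (auto simp: indicator_def)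
    finally show ?thesis using True by simp
  qed simp
  have inner: "(\<integral>\<^sup>+z. indicator K x * indicator K (x - z) \<partial>lborel) = indicator K x * ennreal (measure lebesgue K)" for x
  proof -
    have "(\<integral>\<^sup>+z. indicator K (x - z) \<partial>lborel) = emeasure lborel ((\<lambda>y. (-1) *\<^sub>R y + x) ` K)"
    proof -
      have "indicator K (x - z) = (indicator ((\<lambda>y. (-1) *\<^sub>R y + x) ` K) z :: ennreal)" for z
        by (auto simp: indicator_def image_iff intro: bexI[of _ "x - z"])
      moreover have "compact ((\<lambda>y. (-1) *\<^sub>R y + x) ` K)"
        using K(1) by (intro compact_continuous_image continuous_intros)
      ultimately show ?thesis by (simp add: borel_compact)
    qed
    also have "\<dots> = ennreal (measure lebesgue K)"
      using vol[OF K(1), of "-1" x] by simp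
    finally show ?thesis by (simp add: nn_integral_cmult)
  qed
  have "ennreal ((1/2) ^ DIM('a) * measure lebesgue K) * ennreal ((1/2) ^ DIM('a) * measure lebesgue A)
      = ennreal ((1/2) ^ DIM('a) * measure lebesgue K) * emeasure lborel B"
    unfolding B_def using vol[OF A, of "1/2" 0] by simp
  also have "\<dots> = (\<integral>\<^sup>+z. ennreal ((1/2) ^ DIM('a) * measure lebesgue K) * indicator B z \<partial>lborel)"
    by (simp add: nn_integral_cmult)
  also have "\<dots> \<le> (\<integral>\<^sup>+z. \<integral>\<^sup>+x. indicator K x * indicator K (x - z) \<partial>lborel \<partial>lborel)"
    by (intro nn_integral_mono lower)
  also have "\<dots> = (\<integral>\<^sup>+x. \<integral>\<^sup>+z. indicator K x * indicator K (x - z) \<partial>lborel \<partial>lborel)"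
    by (rule lborel_pair.Fubini') measurable
  also have "\<dots> = (\<integral>\<^sup>+x. indicator K x * ennreal (measure lebesgue K) \<partial>lborel)"
    by (simp only: inner)
  also have "\<dots> = ennreal (measure lebesgue K) * ennreal (measure lebesgue K)"
    by (simp add: nn_integral_multc emeasure_lborel_compact[OF K(1)])
  finally have "((1/2) ^ DIM('a) * measure lebesgue K) * ((1/2) ^ DIM('a) * measure lebesgue A)
      \<le> measure lebesgue K * measure lebesgue K"
    by (simp add: ennreal_mult[symmetric])
  moreover have "0 < measure lebesgue K"
  proof -
    have "\<not> negligible K"
      using open_not_negligible[OF open_interior K(3)] negligible_subset interior_subset by blast
    then have "measure lebesgue K \<noteq> 0"
      using negligible_iff_measure0[OF lmeasurable_compact[OF K(1)]] by blast
    then show ?thesis by (simp add: less_le)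
  qed
  ultimately have "(1/2) ^ DIM('a) * ((1/2) ^ DIM('a) * measure lebesgue A) \<le> measure lebesgue K"
    by (simp add: mult_ac)
  moreover have "(1/2::real) ^ DIM('a) * (1/2) ^ DIM('a) = 1 / 4 ^ DIM('a)"
    by (simp only: power_mult_distrib[symmetric] power_one_over[symmetric]) simp
  ultimately show ?thesis
    by (simp add: A_def field_simps)
qed

text \<open>
If \<open>a \<bullet> z > 1\<close> and \<open>b \<bullet> (- z) > 1\<close> for some \<open>a\<close> and \<open>b\<close> in \<open>K\<close>, then \<open>(a - b) \<bullet> z > 2\<close>.
\<close>

lemma polar_difference_body:
  "(\<lambda>y. 2 *\<^sub>R y) ` polar (difference_body K) \<subseteq> polar K \<union> uminus ` polar K"
proof
  fix z assume "z \<in> (\<lambda>y. 2 *\<^sub>R y) ` polar (difference_body K)"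
  then obtain y where y: "z = 2 *\<^sub>R y" "\<And>a b. a \<in> K \<Longrightarrow> b \<in> K \<Longrightarrow> (a - b) \<bullet> y \<le> 1"
    by (auto simp: polar_def difference_body_def)
  show "z \<in> polar K \<union> uminus ` polar K"
  proof (rule ccontr)
    assume "\<not> ?thesis"
    then have "z \<notin> polar K" "- z \<notin> polar K" by (auto intro: image_eqI[of _ _ "- z"])
    then obtain a b where "a \<in> K" "1 < a \<bullet> z" "b \<in> K" "1 < b \<bullet> - z"
      by (auto simp: polar_def not_le)
    then show False using y(2)[of a b] by (simp add: y(1) inner_diff_left)
  qed
qed

lemma measure_polar_difference_body_le:
  fixes K :: "'a::euclidean_space set"
  assumes K: "0 \<in> interior K"
  shows "2 ^ DIM('a) * measure lebesgue (polar (difference_body K)) \<le> 2 * measure lebesgue (polar K)"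
proof -
  obtain \<rho> where \<rho>: "0 < \<rho>" "cball 0 \<rho> \<subseteq> K" using K by (auto simp: mem_interior_cball)
  have "bounded (polar K)"
    using polar_subset_cball[OF \<rho>(2,1)] bounded_subset bounded_cball by blast
  then have P: "compact (polar K)" using polar_closed compact_eq_bounded_closed by blast
  let ?N = "uminus ` polar K"
  have N: "compact ?N" using P by (rule compact_negations)
  have measN: "measure lebesgue ?N = measure lebesgue (polar K)"
    using measure_lebesgue_affine[of "-1" 0 "polar K"] by simp
  have "2 ^ DIM('a) * measure lebesgue (polar (difference_body K))
      = measure lebesgue ((\<lambda>y. 2 *\<^sub>R y) ` polar (difference_body K))"
    using measure_lebesgue_affine[of 2 0 "polar (difference_body K)"] by simp
  also have "\<dots> \<le> measure lebesgue (polar K \<union> ?N)"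
  proof (rule measure_mono_fmeasurable[OF polar_difference_body])
    have "closed ((\<lambda>y. 2 *\<^sub>R y) ` polar (difference_body K))"
      by (rule closed_scaling[OF polar_closed])
    then show "(\<lambda>y. 2 *\<^sub>R y) ` polar (difference_body K) \<in> sets lebesgue" by auto
    show "polar K \<union> ?N \<in> lmeasurable" using P N by (intro lmeasurable_compact compact_Un)
  qed
  also have "\<dots> \<le> measure lebesgue (polar K) + measure lebesgue ?N"
    using P N by (intro measure_Un_le) (auto intro: lmeasurable_compact fmeasurableD)
  finally show ?thesis using measN by simp
qed

theorem theorem2:
  fixes K :: "(real ^ 'n) set"
  assumes "convex_body K" and "0 \<in> interior K"
  shows "mahler_volume K \<ge> (pi / 4) ^ CARD('n)"
proof -
  let ?n = "CARD('n)"
  have K: "compact K" "convex K" "interior K \<noteq> {}" using assms(1) by (auto simp: convex_body_def)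
  define A where "A = difference_body K"
  have "0 \<in> K" using assms(2) interior_subset by blast
  then have "K \<subseteq> A" by (auto simp: A_def difference_body_def intro: exI[of _ 0]) (metis diff_zero)
  then have int: "0 \<in> interior A" using assms(2) interior_mono by blast
  moreover have "compact A" unfolding A_def difference_body_def by (rule compact_differences[OF K(1,1)])
  moreover have "convex A"
  proof -
    have "A = (\<Union>x\<in>K. \<Union>y\<in>K. {x - y})" by (auto simp: A_def difference_body_def)
    then show ?thesis using convex_differences[OF K(2,2)] by simp
  qed
  ultimately have "convex_body A" by (auto simp: convex_body_def)
  moreover have "uminus ` A = A"
  proof -
    have "- z \<in> A" if "z \<in> A" for z using that unfolding A_def difference_body_def by force
    then show ?thesis by (auto intro: image_eqI[of _ _ "- _"])
  qed
  ultimately have "pi ^ ?n \<le> fact ?n * measure lebesgue A * measure lebesgue (polar A)"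
    using symmetric_mahler_bound[of A] int by (simp add: mahler_volume_def)
  also have "\<dots> \<le> fact ?n * (4 ^ ?n * measure lebesgue K) * (2 * measure lebesgue (polar K) / 2 ^ ?n)"
  proof (intro mult_mono mult_left_mono)
    show "measure lebesgue A \<le> 4 ^ ?n * measure lebesgue K"
      using measure_difference_body_le[OF K] by (simp add: A_def)
    show "measure lebesgue (polar A) \<le> 2 * measure lebesgue (polar K) / 2 ^ ?n"
      using measure_polar_difference_body_le[OF assms(2)] by (simp add: A_def field_simps)
  qed auto
  also have "\<dots> = 2 * 2 ^ ?n * mahler_volume K"
  proof -
    have "(4::real) ^ ?n = 2 ^ ?n * 2 ^ ?n" by (simp only: power_mult_distrib[symmetric]) simp
    then show ?thesis by (simp add: mahler_volume_def)
  qed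
  also have "\<dots> \<le> 2 ^ ?n * 2 ^ ?n * mahler_volume K"
  proof -
    have "(2::real) ^ 1 \<le> 2 ^ ?n" by (intro power_increasing) (simp_all add: Suc_le_eq)
    moreover have "0 \<le> mahler_volume K" by (simp add: mahler_volume_def)
    ultimately show ?thesis by (intro mult_right_mono) auto
  qed
  also have "(2::real) ^ ?n * 2 ^ ?n = 4 ^ ?n" by (simp only: power_mult_distrib[symmetric]) simp
  finally show ?thesis by (simp add: power_divide field_simps)
qed

end
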